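(* Consider the semi-discrete (continuous in time) nodal Gauss--Lobatto DG scheme for the Navier--Stokes/Cahn--Hilliard system described in the context, with zero source term, with the inviscid numerical and diamond fluxes (at all interior and boundary faces) chosen either as the central fluxes or as the exact Riemann solver (ERS) fluxes, with the Bassi--Rebay 1 fluxes with penalty parameter $\beta\ge0$ for the viscous and Cahn--Hilliard terms, and with free-slip or no-slip wall boundary conditions at all physical boundary faces. Define the discrete entropy $$\bar{\mathcal E}^\beta=\sum_e\langle\mathcal J\mathcal E,1\rangle_{E,N}+\tfrac34\sigma\varepsilon\sum_{\text{interior faces}}\int_{f,N}\beta\,[\![C]\!]^2\,dS,\qquad \mathcal E=f_0(C)+\tfrac34\sigma\varepsilon|\vec G_c|^2+\tfrac12\rho|\vec U|^2+\frac{P^2}{2\rho_0c_0^2}.$$ Then $\bar{\mathcal E}^\beta\ge 0$ and every (time-differentiable) solution of the scheme satisfies $$\frac{d}{dt}\left(\bar{\mathcal E}^\beta+\sum_{\text{boundary faces}}\int_{f,N}f_w(C)\,dS\right)\ \le\ -\sum_e\left\langle\mathcal J\left(M_0|\vec G_\mu|^2+2\eta\,\mathcal S:\mathcal S\right),1\right\rangle_{E,N}.$$ For central fluxes and $\beta=0$ this holds with equality. In particular, for either choice of inviscid fluxes, the discrete entropy plus the discrete surface free energy, $\bar{\mathcal E}^\beta+\sum_{\text{boundary faces}}\int_{f,N}f_w(C)\,dS$, is bounded by its initial value.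
   Context: **Parameters.** $\sigma,\varepsilon,M_0,\rho_1,\rho_2,\eta_1,\eta_2,c_0>0$ are constants, $\rho_0=\max(\rho_1,\rho_2)$; $f_0(c)=\frac{12\sigma}{\varepsilon}c^2(1-c)^2$; $\rho=\rho(C)=\rho_1\hat C+\rho_2(1-\hat C)>0$ with $\hat C=\min(\max(C,0),1)$; $\eta=\eta_1C+\eta_2(1-C)$, assumed non-negative; $f_w$ is a differentiable boundary free-energy function (e.g. $f_w(c)=\frac12\sigma\cos\theta_w(2c-1)(1+2c-2c^2)$). **Mesh and quadrature.** $\Omega\subset\mathbb R^3$ is tessellated by non-overlapping, conforming, possibly curved hexahedral elements $e$, each the image of $E=[-1,1]^3$ under a polynomial map $\vec{\mathcal X}$ of degree $\le N$ (in each variable) with coordinates $\vec\xi=(\xi^1,\xi^2,\xi^3)$. $\mathbb P^N$ is the space of polynomials of degree $\le N$ in each variable on $E$, represented by nodal values at the tensor-product Gauss--Lobatto points with one-dimensional weights $\omega_i$; $\mathbb I^N$ is interpolation at these nodes. All nonlinear quantities are represented by interpolation of their nodal values. $\langle f,g\rangle_{E,N}=\sum_{ijk}\omega_i\omega_j\omega_k f_{ijk}g_{ijk}$, extended by summation over components for vector-valued quantities. $\mathcal J>0$ is the nodal Jacobian; the metric terms are $\mathcal Ja^i_n=-\hat x_i\cdot\nabla_\xi\times(\mathbb I^N(\mathcal X_l\nabla_\xi\mathcal X_m))\in\mathbb P^N$, $(n,m,l)$ cyclic. For a flux $F=(F_1,F_2,F_3)$ (three Cartesian components) the contravariant flux is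 $\tilde F^i=\mathbb I^N(\sum_n\mathcal Ja^i_nF_n)$. $\int_{\partial e,N}$ and $\int_{f,N}$ are Gauss--Lobatto quadratures over element faces: $\int_{\partial e,N}F\cdot\vec n\,dS$ is the tensor Gauss--Lobatto quadrature of $\tilde F\cdot\hat n$ over the six faces of $E$ ($\hat n$ the reference outward normal), where $\vec n$ is the outward physical unit normal and the surface Jacobian is $\mathcal J_f=|\mathcal J\vec a^i|$. Face nodes, surface Jacobians and normals (up to sign) coincide on the two sides of interior faces. At an interior face, $L,R$ denote values from left and right elements, $\vec n_L$ is the outward normal of the left element, $\{\!\{u\}\!\}=\frac12(u_L+u_R)$, $[\![u]\!]=u_R-u_L$. **Variables.** State $\mathbf Q=(C,\sqrt\rho\,\vec U,P)\in\mathbb R^5$, with $\vec U=(U_1,U_2,U_3)$; entropy variables $\mathbf W=(W_1,\dots,W_5)=(\mu,U_1,U_2,U_3,P/(\rho_0c_0^2))$; mass matrix $\underline{\mathbf M}=\mathrm{diag}(1,\sqrt\rho,\sqrt\rho,\sqrt\rho,1)$. A block vector has five rows, each a vector in $\mathbb R^3$; $\mathbf e_1,\dots,\mathbf e_5$ are the unit state vectors and $\vec e_i$ the unit space vectors. - Inviscid flux $\mathbf F_e$: row $1$: $C\vec U$; row $i+1$ ($i=1,2,3$): $\frac12\rho U_i\vec U+P\vec e_i$; row $5$: $\vec 0$. - Non-conservative coefficients (block vectors): $\mathbf\Phi_1$ has rows $(\vec 0,C\vec e_1,C\vec e_2,C\vec e_3,\vec 0)$; for $i=1,2,3$, $\mathbf\Phi_{i+1}$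 has row $i+1$ equal to $\frac12\rho\vec U$, row $5$ equal to $\rho_0c_0^2\vec e_i$, other rows zero; $\mathbf\Phi_5=0$. - Viscous flux $\mathbf F_v(\mathbf G)$: row $1$: $M_0\vec G_\mu$; row $i+1$: $2\eta\,\mathcal S\vec e_i$; row $5$: $\vec 0$, where $\mathbf G$ is the block vector approximating $\nabla\mathbf W$, $\vec G_\mu$ is its first row, $\vec G_{\vec u}$ is the discrete velocity gradient (rows $2$–$4$), and $\mathcal S=\frac12(\vec G_{\vec u}+\vec G_{\vec u}^T)$. **Scheme.** Find $\mathbf Q,\mathbf G,\mu,\vec G_c$ with components in $\mathbb P^N$ on each element (no inter-element continuity) such that for all polynomial test functions $\boldsymbol\varphi_q,\boldsymbol\varphi_g,\varphi_\mu,\vec\varphi_c$ with components in $\mathbb P^N$ and all elements $$\langle\mathcal J\underline{\mathbf M}\mathbf Q_t,\boldsymbol\varphi_q\rangle_{E,N}+\int_{\partial e,N}\boldsymbol\varphi_q^T\Big(\mathbf F_e^\star-\mathbf F_e+\sum_{m=1}^5\big[(\mathbf\Phi_mW_m)^\diamondsuit-\mathbf\Phi_mW_m\big]\Big)\cdot\vec n\,dS+\langle\boldsymbol\varphi_q,\nabla_\xi\cdot\tilde{\mathbf F}_e\rangle_{E,N}+\sum_{m=1}^5\langle\boldsymbol\varphi_q,\tilde{\mathbf\Phi}_m\cdot\nabla_\xi W_m\rangle_{E,N}$$ $$=\int_{\partial e,N}\boldsymbol\varphi_q^T\mathbf F_v^\star\cdot\vec n\,dS-\langle\tilde{\mathbf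 F}_v,\nabla_\xi\boldsymbol\varphi_q\rangle_{E,N},$$ $$\langle\mathcal J\mathbf G,\boldsymbol\varphi_g\rangle_{E,N}=\int_{\partial e,N}(\mathbf W^\star-\mathbf W)^T(\boldsymbol\varphi_g\cdot\vec n)\,dS+\langle\tilde{\boldsymbol\varphi}_g,\nabla_\xi\mathbf W\rangle_{E,N},$$ $$\langle\mathcal J\mu,\varphi_\mu\rangle_{E,N}=\langle\mathcal Jf_0'(C),\varphi_\mu\rangle_{E,N}-\int_{\partial e,N}\tfrac32\sigma\varepsilon\,\varphi_\mu\vec G_c^\star\cdot\vec n\,dS+\langle\tfrac32\sigma\varepsilon\,\tilde{\vec G}_c,\nabla_\xi\varphi_\mu\rangle_{E,N},$$ $$\langle\mathcal J\vec G_c,\vec\varphi_c\rangle_{E,N}=\int_{\partial e,N}(C^\star-C)\,\vec\varphi_c\cdot\vec n\,dS+\langle\tilde{\vec\varphi}_c,\nabla_\xi C\rangle_{E,N}.$$ **Inviscid interface fluxes.** With $\vec t_1,\vec t_2$ unit tangents completing the normal to an orthonormal frame, let $\mathbf T$ be the $5\times5$ rotation acting on the velocity components by $\vec U\mapsto(U_n,V_{t1},V_{t2})=(\vec U\cdot\vec n,\vec U\cdot\vec t_1,\vec U\cdot\vec t_2)$ and as identity on components $1$ and $5$; here the normal is $\vec n=\vec n_L$ (for the right element the normal flux changes sign). Quantities without average or star are the element's own local trace. (i) Central: $\mathbf F_e^\star=\{\!\{\mathbf F_e\}\!\}$ and $(\mathbf\Phi_mW_m)^\diamondsuit=\mathbf\Phi_m\{\!\{W_m\}\!\}$.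 (ii) ERS: set $a=\sqrt{U_n^2+4\rho_0c_0^2/\rho}$ and $\lambda^\pm=\frac12(U_n\pm a)$ on each side, and $$U_n^\star=\frac{P_L-P_R+\rho_LU_{nL}\lambda_L^+-\rho_RU_{nR}\lambda_R^-}{\rho_L\lambda_L^+-\rho_R\lambda_R^-},\quad P^\star=P_L+\rho_L\lambda_L^+(U_{nL}-U_n^\star),\quad \rho_L^\star=\frac{\rho_L\lambda_L^+}{U_n^\star-\lambda_L^-},\quad \rho_R^\star=\frac{\rho_R\lambda_R^-}{U_n^\star-\lambda_R^+},$$ $\rho^\star=\rho_L^\star$, $V_{ti}^\star=V_{tiL}$ if $U_n^\star\ge0$, and $\rho^\star=\rho_R^\star$, $V_{ti}^\star=V_{tiR}$ if $U_n^\star<0$. Then $$\mathbf F_e^\star\cdot\vec n=\mathbf T^T\big(\{\!\{CU_n\}\!\},\ \tfrac12\rho^\star U_n^{\star2}+P^\star,\ \tfrac12\rho^\star U_n^\star V_{t1}^\star,\ \tfrac12\rho^\star U_n^\star V_{t2}^\star,\ 0\big)^T,$$ $$\sum_m(\mathbf\Phi_mW_m)^\diamondsuit\cdot\vec n=\mathbf T^T\begin{pmatrix}0\\ \tfrac12\rho^\star U_n^{\star2}+\tfrac12\rho U_n^2-\tfrac12\rho^\star U_n^\star U_n+C\{\!\{\mu\}\!\}\\ \tfrac12\rho^\star U_n^\star V_{t1}^\star+\tfrac12\rho U_nV_{t1}-\tfrac12\rho^\star U_n^\star V_{t1}\\ \tfrac12\rho^\star U_n^\star V_{t2}^\star+\tfrac12\rho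 U_nV_{t2}-\tfrac12\rho^\star U_n^\star V_{t2}\\ \rho_0c_0^2U_n^\star\end{pmatrix}.$$ **Viscous/Cahn--Hilliard interface fluxes (BR1).** $\mathbf W^\star=\{\!\{\mathbf W\}\!\}$, $\mathbf F_v^\star=\{\!\{\mathbf F_v\}\!\}+\beta[\![\mu]\!]\mathbf e_1\vec n_L$, $C^\star=\{\!\{C\}\!\}$, $\vec G_c^\star=\{\!\{\vec G_c\}\!\}+\beta[\![C]\!]\vec n_L$, with time-independent $\beta=\kappa_\beta\frac{N(N+1)}2|\mathcal J_f|\{\!\{\mathcal J^{-1}\}\!\}$, $\kappa_\beta\ge0$ a free parameter ($\kappa_\beta=0$: no interface stabilization). **Wall boundary faces.** Inviscid: the chosen flux (central or ERS) is applied with interior state on the left and mirrored ghost state on the right (same $C,\mu,P,V_{t1},V_{t2}$, opposite $U_n$). This gives, for central: $\mathbf F_e^\star\cdot\vec n=\mathbf T^T(0,\frac12\rho U_n^2+P,0,0,0)^T$, $\sum_m(\mathbf\Phi_mW_m)^\diamondsuit\cdot\vec n=\mathbf T^T(0,C\mu,\frac12\rho U_nV_{t1},\frac12\rho U_nV_{t2},0)^T$; for ERS: $\mathbf F_e^\star\cdot\vec n=\mathbf T^T(0,P+\rho\lambda^+U_n,0,0,0)^T$, $\sum_m(\mathbf\Phi_mW_m)^\diamondsuit\cdot\vec n=\mathbf T^T(0,\frac12\rho U_n^2+C\mu,\frac12\rho U_nV_{t1},\frac12\rho U_nV_{t2},0)^T$. Cahn--Hilliard: $C^\star=C$ and $-\frac32\sigma\varepsilon\,\vec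 G_c^\star\cdot\vec n=f_w'(C)$. Free-slip: $\mathbf W^\star=\mathbf W$, $\mathbf F_v^\star\cdot\vec n=0$. No-slip: $\mathbf W^\star=(\mu,0,0,0,P/(\rho_0c_0^2))$, $\mathbf F_v^\star\cdot\vec n=(0,2\eta\,\mathcal S\vec n,0)^T$. *)

theory Defs
  imports "HOL-Analysis.Analysis" "HOL-Computational_Algebra.Polynomial"
begin

section \<open>Nodal Gauss--Lobatto calculus on the reference cube\<close>

text \<open>
  A polynomial of degree at most \<open>N\<close> in each variable on \<open>E = [-1,1]\<^sup>3\<close> is represented by its
  values at the tensor-product nodes. A node is a multi-index \<open>p :: 3 \<Rightarrow> nat\<close> with entries
  \<open>\<le> N\<close>; values of a nodal function at other multi-indices are never used.
\<close>

type_synonym mindex = "3 \<Rightarrow> nat"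

text \<open>Exactness up to degree \<open>2N - 1\<close> with both end points among the \<open>N + 1\<close> nodes determines the nodes
  and weights uniquely; in particular it forces the weights to be positive.\<close>

definition gauss_lobatto :: "nat \<Rightarrow> (nat \<Rightarrow> real) \<Rightarrow> (nat \<Rightarrow> real) \<Rightarrow> bool" where
  "gauss_lobatto N x w \<longleftrightarrow>
     1 \<le> N \<and> x 0 = -1 \<and> x N = 1 \<and> strict_mono_on {..N} x \<and>
     (\<forall>f :: real poly. degree f \<le> 2 * N - 1 \<longrightarrow>
        (\<Sum>i\<le>N. w i * poly f (x i)) = integral {-1..1} (poly f))"

definition lagrange :: "nat \<Rightarrow> (nat \<Rightarrow> real) \<Rightarrow> nat \<Rightarrow> real poly" where
  "lagrange N x j = (\<Prod>m\<in>{..N} - {j}. smult (1 / (x j - x m)) [:- x m, 1:])"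

definition nodes :: "nat \<Rightarrow> mindex set" where
  "nodes N = {p. \<forall>d. p d \<le> N}"

definition interp :: "nat \<Rightarrow> (nat \<Rightarrow> real) \<Rightarrow> (mindex \<Rightarrow> 'a::real_vector) \<Rightarrow> real^3 \<Rightarrow> 'a" where
  "interp N x f \<xi> = (\<Sum>p\<in>nodes N. (\<Prod>d\<in>UNIV. poly (lagrange N x (p d)) (\<xi> $ d)) *\<^sub>R f p)"

text \<open>The partial derivative in reference direction \<open>d\<close> of the interpolating polynomial, at node \<open>p\<close>.\<close>

definition pd :: "nat \<Rightarrow> (nat \<Rightarrow> real) \<Rightarrow> 3 \<Rightarrow> (mindex \<Rightarrow> 'a::real_vector) \<Rightarrow> mindex \<Rightarrow> 'a" where
  "pd N x d f p = (\<Sum>m\<le>N. poly (pderiv (lagrange N x m)) (x (p d)) *\<^sub>R f (p(d := m)))"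

definition grad :: "nat \<Rightarrow> (nat \<Rightarrow> real) \<Rightarrow> (mindex \<Rightarrow> real) \<Rightarrow> mindex \<Rightarrow> real^3" where
  "grad N x f p = (\<chi> d. pd N x d f p)"

definition bgrad :: "nat \<Rightarrow> (nat \<Rightarrow> real) \<Rightarrow> (mindex \<Rightarrow> real^5) \<Rightarrow> mindex \<Rightarrow> real^3^5" where
  "bgrad N x f p = (\<chi> r. grad N x (\<lambda>q. f q $ r) p)"

definition bdiv :: "nat \<Rightarrow> (nat \<Rightarrow> real) \<Rightarrow> (mindex \<Rightarrow> real^3^5) \<Rightarrow> mindex \<Rightarrow> real^5" where
  "bdiv N x F p = (\<chi> r. \<Sum>d\<in>UNIV. pd N x d (\<lambda>q. F q $ r $ d) p)"

text \<open>Index arithmetic in the type \<open>3\<close> is modulo 3, so \<open>(i, i + 1, i + 2)\<close> is always cyclic.\<close>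

definition curl :: "nat \<Rightarrow> (nat \<Rightarrow> real) \<Rightarrow> (mindex \<Rightarrow> real^3) \<Rightarrow> mindex \<Rightarrow> real^3" where
  "curl N x V p =
     (\<chi> i. pd N x (i + 1) (\<lambda>q. V q $ (i + 2)) p - pd N x (i + 2) (\<lambda>q. V q $ (i + 1)) p)"

text \<open>
  The discrete inner product \<open>\<langle>f,g\<rangle>\<^sub>E\<^sub>,\<^sub>N\<close>. The library inner product of \<open>real^3\<close>, \<open>real^5\<close> and
  \<open>real^3^5\<close> supplies the summation over components.
\<close>

definition vinner ::
  "nat \<Rightarrow> (nat \<Rightarrow> real) \<Rightarrow> (mindex \<Rightarrow> 'a::real_inner) \<Rightarrow> (mindex \<Rightarrow> 'a) \<Rightarrow> real" where
  "vinner N w f g = (\<Sum>p\<in>nodes N. (\<Prod>d\<in>UNIV. w (p d)) * (f p \<bullet> g p))"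

section \<open>Five-row vectors\<close>

definition blk :: "'a \<Rightarrow> 'a^3 \<Rightarrow> 'a \<Rightarrow> 'a^5" where
  "blk a u b = (\<chi> r. if r = 1 then a else if r = 2 then u $ 1 else if r = 3 then u $ 2
                     else if r = 4 then u $ 3 else b)"

definition vrows :: "'a^5 \<Rightarrow> 'a^3" where
  "vrows v = (\<chi> i. if i = 1 then v $ 2 else if i = 2 then v $ 3 else v $ 4)"

definition bdot :: "real^3^5 \<Rightarrow> real^3 \<Rightarrow> real^5" where
  "bdot F n = (\<chi> r. F $ r \<bullet> n)"

section \<open>Mesh\<close>

text \<open>
  A local face \<open>(e, d, s)\<close> is the face \<open>\<xi>\<^sup>d = 1\<close> (\<open>s\<close> true) or \<open>\<xi>\<^sup>d = -1\<close> (\<open>s\<close> false) of element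
  \<open>e\<close>. For an interior local face \<open>l\<close>, \<open>nbr l\<close> is the local face of the adjacent element occupying
  the same position, \<open>nmap l\<close> sends the nodes of \<open>l\<close> to the coinciding nodes of \<open>nbr l\<close>, and
  \<open>is_left l\<close> says whether \<open>l\<close> is the left side of the interface.
  \<open>frame l p\<close> has the rows \<open>n\<close>, \<open>t\<^sub>1\<close>, \<open>t\<^sub>2\<close>.
\<close>

type_synonym 'e lface = "'e \<times> 3 \<times> bool"

datatype wall = FreeSlip | NoSlip

record 'e dg =
  deg :: nat
  node :: "nat \<Rightarrow> real"
  wgt :: "nat \<Rightarrow> real"
  elems :: "'e set"
  pos :: "'e \<Rightarrow> mindex \<Rightarrow> real^3"
  bfaces :: "'e lface set"
  nbr :: "'e lface \<Rightarrow> 'e lface"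
  nmap :: "'e lface \<Rightarrow> mindex \<Rightarrow> mindex"
  is_left :: "'e lface \<Rightarrow> bool"
  frame :: "'e lface \<Rightarrow> mindex \<Rightarrow> real^3^3"
  wall_bc :: "'e lface \<Rightarrow> wall"

definition lfaces :: "'e dg \<Rightarrow> 'e lface set" where
  "lfaces D = elems D \<times> UNIV"

text \<open>Every interior face is counted once, through its left side.\<close>

definition left_faces :: "'e dg \<Rightarrow> 'e lface set" where
  "left_faces D = {l \<in> lfaces D - bfaces D. is_left D l}"

definition face_nodes :: "'e dg \<Rightarrow> 'e lface \<Rightarrow> mindex set" where
  "face_nodes D = (\<lambda>(e, d, s). {p \<in> nodes (deg D). p d = (if s then deg D else 0)})"

definition element_map :: "'e dg \<Rightarrow> 'e \<Rightarrow> real^3 \<Rightarrow> real^3" where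
  "element_map D e = interp (deg D) (node D) (pos D e)"

definition ref_cube :: "(real^3) set" where
  "ref_cube = {\<xi>. \<forall>d. -1 \<le> \<xi> $ d \<and> \<xi> $ d \<le> 1}"

definition ref_face :: "3 \<Rightarrow> bool \<Rightarrow> (real^3) set" where
  "ref_face d s = {\<xi> \<in> ref_cube. \<xi> $ d = (if s then 1 else -1)}"

definition jac :: "'e dg \<Rightarrow> 'e \<Rightarrow> mindex \<Rightarrow> real" where
  "jac D e p = det (\<chi> n i. pd (deg D) (node D) i (\<lambda>q. pos D e q $ n) p)"

text \<open>Row \<open>i\<close> of \<open>metric D e p\<close> is the vector of the metric terms of index \<open>i\<close>, so that the
  contravariant flux of \<open>F\<close> is \<open>metric D e p *v F\<close>. In the curl form \<open>(n, m, l)\<close> is \<open>(n, n + 1, n + 2)\<close>.\<close>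

definition metric :: "'e dg \<Rightarrow> 'e \<Rightarrow> mindex \<Rightarrow> real^3^3" where
  "metric D e p = (\<chi> i n. - (curl (deg D) (node D)
       (\<lambda>q. (pos D e q $ (n + 2)) *\<^sub>R grad (deg D) (node D) (\<lambda>q'. pos D e q' $ (n + 1)) q) p $ i))"

definition contra :: "'e dg \<Rightarrow> 'e \<Rightarrow> (mindex \<Rightarrow> real^3) \<Rightarrow> mindex \<Rightarrow> real^3" where
  "contra D e F p = metric D e p *v F p"

definition bcontra :: "'e dg \<Rightarrow> 'e \<Rightarrow> (mindex \<Rightarrow> real^3^5) \<Rightarrow> mindex \<Rightarrow> real^3^5" where
  "bcontra D e F p = (\<chi> r. metric D e p *v (F p $ r))"

definition sjac :: "'e dg \<Rightarrow> 'e lface \<Rightarrow> mindex \<Rightarrow> real" where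
  "sjac D = (\<lambda>(e, d, s) p. norm (metric D e p $ d))"

definition nvec :: "'e dg \<Rightarrow> 'e lface \<Rightarrow> mindex \<Rightarrow> real^3" where
  "nvec D = (\<lambda>(e, d, s) p. ((if s then 1 else -1) / norm (metric D e p $ d)) *\<^sub>R (metric D e p $ d))"

definition fweight :: "'e dg \<Rightarrow> 'e lface \<Rightarrow> mindex \<Rightarrow> real" where
  "fweight D = (\<lambda>(e, d, s) p. \<Prod>k\<in>UNIV - {d}. wgt D (p k))"

definition face_int :: "'e dg \<Rightarrow> 'e lface \<Rightarrow> (mindex \<Rightarrow> real) \<Rightarrow> real" where
  "face_int D l g = (\<Sum>p\<in>face_nodes D l. fweight D l p * sjac D l p * g p)"

definition elem_bd_int :: "'e dg \<Rightarrow> 'e \<Rightarrow> ('e lface \<Rightarrow> mindex \<Rightarrow> real) \<Rightarrow> real" where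
  "elem_bd_int D e g = (\<Sum>(d, s)\<in>UNIV. face_int D (e, d, s) (g (e, d, s)))"

text \<open>
  The node correspondence of two coinciding faces is one of the eight symmetries of the
  square grid: tangential directions are matched by \<open>\<pi>\<close> and reversed where \<open>r\<close> holds.
\<close>

definition grid_match :: "'e dg \<Rightarrow> 'e lface \<Rightarrow> 'e lface \<Rightarrow> (mindex \<Rightarrow> mindex) \<Rightarrow> bool" where
  "grid_match D l l' \<tau> \<longleftrightarrow>
     (\<forall>p\<in>face_nodes D l. \<tau> p \<in> face_nodes D l') \<and>
     (\<exists>\<pi> r. bij \<pi> \<and> \<pi> (fst (snd l)) = fst (snd l') \<and>
        (\<forall>p\<in>face_nodes D l. \<forall>k. k \<noteq> fst (snd l) \<longrightarrow>
           \<tau> p (\<pi> k) = (if r k then deg D - p k else p k)))"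

definition dg_mesh :: "(real^3) set \<Rightarrow> 'e dg \<Rightarrow> bool" where
  "dg_mesh \<Omega> D \<longleftrightarrow>
     gauss_lobatto (deg D) (node D) (wgt D) \<and>
     finite (elems D) \<and>
     closure \<Omega> = (\<Union>e\<in>elems D. element_map D e ` ref_cube) \<and>
     disjoint_family_on (\<lambda>e. interior (element_map D e ` ref_cube)) (elems D) \<and>
     (\<forall>e\<in>elems D. \<forall>p\<in>nodes (deg D). 0 < jac D e p) \<and>
     (\<forall>l\<in>lfaces D. \<forall>p\<in>face_nodes D l. 0 < sjac D l p) \<and>
     bfaces D \<subseteq> lfaces D \<and>
     (\<forall>(e, d, s)\<in>bfaces D. element_map D e ` ref_face d s \<subseteq> frontier \<Omega>) \<and>
     (\<forall>l\<in>lfaces D - bfaces D.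
        nbr D l \<in> lfaces D - bfaces D \<and> fst (nbr D l) \<noteq> fst l \<and>
        nbr D (nbr D l) = l \<and> is_left D (nbr D l) = (\<not> is_left D l) \<and>
        grid_match D l (nbr D l) (nmap D l) \<and>
        (\<forall>p\<in>face_nodes D l.
           nmap D (nbr D l) (nmap D l p) = p \<and>
           pos D (fst (nbr D l)) (nmap D l p) = pos D (fst l) p \<and>
           sjac D (nbr D l) (nmap D l p) = sjac D l p \<and>
           nvec D (nbr D l) (nmap D l p) = - nvec D l p)) \<and>
     (\<forall>l\<in>left_faces D \<union> bfaces D. \<forall>p\<in>face_nodes D l.
        orthogonal_matrix (frame D l p) \<and> frame D l p $ 1 = nvec D l p)"

section \<open>Physical model\<close>

record params =
  sigma :: real
  eps :: real
  M0 :: real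
  rho1 :: real
  rho2 :: real
  eta1 :: real
  eta2 :: real
  c0 :: real
  kappa :: real
  fw :: "real \<Rightarrow> real"

definition valid_params :: "params \<Rightarrow> bool" where
  "valid_params par \<longleftrightarrow>
     0 < sigma par \<and> 0 < eps par \<and> 0 < M0 par \<and> 0 < rho1 par \<and> 0 < rho2 par \<and>
     0 < eta1 par \<and> 0 < eta2 par \<and> 0 < c0 par \<and> 0 \<le> kappa par \<and>
     (\<forall>c. fw par differentiable (at c))"

definition rho0 :: "params \<Rightarrow> real" where
  "rho0 par = max (rho1 par) (rho2 par)"

definition f0 :: "params \<Rightarrow> real \<Rightarrow> real" where
  "f0 par c = 12 * sigma par / eps par * c^2 * (1 - c)^2"

definition rho :: "params \<Rightarrow> real \<Rightarrow> real" where
  "rho par c = (let c' = min (max c 0) 1 in rho1 par * c' + rho2 par * (1 - c'))"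

definition eta :: "params \<Rightarrow> real \<Rightarrow> real" where
  "eta par c = eta1 par * c + eta2 par * (1 - c)"

text \<open>Nodal state \<open>q = (C, \<surd>\<rho> U, P)\<close>; the velocity is recovered by dividing by \<open>\<surd>\<rho>\<close>.\<close>

definition conc :: "real^5 \<Rightarrow> real" where
  "conc q = q $ 1"

definition pres :: "real^5 \<Rightarrow> real" where
  "pres q = q $ 5"

definition dens :: "params \<Rightarrow> real^5 \<Rightarrow> real" where
  "dens par q = rho par (conc q)"

definition vel :: "params \<Rightarrow> real^5 \<Rightarrow> real^3" where
  "vel par q = (1 / sqrt (dens par q)) *\<^sub>R vrows q"

definition Wvar :: "params \<Rightarrow> real^5 \<Rightarrow> real \<Rightarrow> real^5" where
  "Wvar par q m = blk m (vel par q) (pres q / (rho0 par * (c0 par)^2))"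

definition mass :: "params \<Rightarrow> real^5 \<Rightarrow> real^5^5" where
  "mass par q =
     (\<chi> i j. if i = j then blk 1 (\<chi> k. sqrt (dens par q)) 1 $ i else 0)"

definition Fe :: "params \<Rightarrow> real^5 \<Rightarrow> real^3^5" where
  "Fe par q = blk (conc q *\<^sub>R vel par q)
     (\<chi> i. (1/2 * dens par q * vel par q $ i) *\<^sub>R vel par q + pres q *\<^sub>R axis i 1)
     0"

text \<open>\<open>Phi par q $ m\<close> is the \<open>m\<close>-th non-conservative coefficient, itself a block vector.\<close>

definition Phi :: "params \<Rightarrow> real^5 \<Rightarrow> real^3^5^5" where
  "Phi par q = blk
     (blk 0 (\<chi> i. conc q *\<^sub>R axis i 1) 0)
     (\<chi> i. blk 0 (axis i ((1/2 * dens par q) *\<^sub>R vel par q)) ((rho0 par * (c0 par)^2) *\<^sub>R axis i 1))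
     0"

definition strain :: "real^3^5 \<Rightarrow> real^3^3" where
  "strain g = (1/2) *\<^sub>R (vrows g + transpose (vrows g))"

definition Fv :: "params \<Rightarrow> real^5 \<Rightarrow> real^3^5 \<Rightarrow> real^3^5" where
  "Fv par q g = blk (M0 par *\<^sub>R g $ 1)
     (\<chi> i. (2 * eta par (conc q)) *\<^sub>R (strain g *v axis i 1)) 0"

section \<open>Inviscid interface fluxes\<close>

text \<open>
  All fluxes below are normal fluxes with respect to the normal \<open>R $ 1\<close> of the frame \<open>R\<close>, which
  points from left to right. Traces are pairs \<open>(q, \<mu>)\<close>.
\<close>

type_synonym trace = "(real^5) \<times> real"

datatype iflux = Central | ERS

definition rotT :: "real^3^3 \<Rightarrow> real^5^5" where
  "rotT R = blk (axis 1 1) (\<chi> k. blk 0 (R $ k) 0) (axis 5 1)"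

definition Vn :: "params \<Rightarrow> real^3^3 \<Rightarrow> trace \<Rightarrow> real" where
  "Vn par R z = (R *v vel par (fst z)) $ 1"

definition Vt1 :: "params \<Rightarrow> real^3^3 \<Rightarrow> trace \<Rightarrow> real" where
  "Vt1 par R z = (R *v vel par (fst z)) $ 2"

definition Vt2 :: "params \<Rightarrow> real^3^3 \<Rightarrow> trace \<Rightarrow> real" where
  "Vt2 par R z = (R *v vel par (fst z)) $ 3"

definition ers_a :: "params \<Rightarrow> real^3^3 \<Rightarrow> trace \<Rightarrow> real" where
  "ers_a par R z = sqrt ((Vn par R z)^2 + 4 * rho0 par * (c0 par)^2 / dens par (fst z))"

definition lam_plus :: "params \<Rightarrow> real^3^3 \<Rightarrow> trace \<Rightarrow> real" where
  "lam_plus par R z = 1/2 * (Vn par R z + ers_a par R z)"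

definition lam_minus :: "params \<Rightarrow> real^3^3 \<Rightarrow> trace \<Rightarrow> real" where
  "lam_minus par R z = 1/2 * (Vn par R z - ers_a par R z)"

definition Vn_star :: "params \<Rightarrow> real^3^3 \<Rightarrow> trace \<Rightarrow> trace \<Rightarrow> real" where
  "Vn_star par R zL zR =
     (pres (fst zL) - pres (fst zR)
        + dens par (fst zL) * Vn par R zL * lam_plus par R zL
        - dens par (fst zR) * Vn par R zR * lam_minus par R zR)
     / (dens par (fst zL) * lam_plus par R zL - dens par (fst zR) * lam_minus par R zR)"

definition P_star :: "params \<Rightarrow> real^3^3 \<Rightarrow> trace \<Rightarrow> trace \<Rightarrow> real" where
  "P_star par R zL zR =
     pres (fst zL) + dens par (fst zL) * lam_plus par R zL * (Vn par R zL - Vn_star par R zL zR)"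

definition rho_star :: "params \<Rightarrow> real^3^3 \<Rightarrow> trace \<Rightarrow> trace \<Rightarrow> real" where
  "rho_star par R zL zR =
     (if Vn_star par R zL zR \<ge> 0
      then dens par (fst zL) * lam_plus par R zL / (Vn_star par R zL zR - lam_minus par R zL)
      else dens par (fst zR) * lam_minus par R zR / (Vn_star par R zL zR - lam_plus par R zR))"

definition Vt1_star :: "params \<Rightarrow> real^3^3 \<Rightarrow> trace \<Rightarrow> trace \<Rightarrow> real" where
  "Vt1_star par R zL zR = (if Vn_star par R zL zR \<ge> 0 then Vt1 par R zL else Vt1 par R zR)"

definition Vt2_star :: "params \<Rightarrow> real^3^3 \<Rightarrow> trace \<Rightarrow> trace \<Rightarrow> real" where
  "Vt2_star par R zL zR = (if Vn_star par R zL zR \<ge> 0 then Vt2 par R zL else Vt2 par R zR)"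

definition Fe_star :: "iflux \<Rightarrow> params \<Rightarrow> real^3^3 \<Rightarrow> trace \<Rightarrow> trace \<Rightarrow> real^5" where
  "Fe_star flx par R zL zR = (case flx of
     Central \<Rightarrow> bdot ((1/2) *\<^sub>R (Fe par (fst zL) + Fe par (fst zR))) (R $ 1)
   | ERS \<Rightarrow>
      (let u = Vn_star par R zL zR; r = rho_star par R zL zR in
       transpose (rotT R) *v blk
         (1/2 * (conc (fst zL) * Vn par R zL + conc (fst zR) * Vn par R zR))
         (vector [1/2 * r * u^2 + P_star par R zL zR,
                  1/2 * r * u * Vt1_star par R zL zR,
                  1/2 * r * u * Vt2_star par R zL zR])
         0))"

text \<open>The diamond flux depends on the local trace \<open>z\<close>, which is either \<open>zL\<close> or \<open>zR\<close>.\<close>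

definition Phi_diamond ::
  "iflux \<Rightarrow> params \<Rightarrow> real^3^3 \<Rightarrow> trace \<Rightarrow> trace \<Rightarrow> trace \<Rightarrow> real^5" where
  "Phi_diamond flx par R zL zR z = (case flx of
     Central \<Rightarrow>
       (\<Sum>m\<in>UNIV. (1/2 * (Wvar par (fst zL) (snd zL) $ m + Wvar par (fst zR) (snd zR) $ m))
                    *\<^sub>R bdot (Phi par (fst z) $ m) (R $ 1))
   | ERS \<Rightarrow>
      (let u = Vn_star par R zL zR; r = rho_star par R zL zR;
           d = dens par (fst z); un = Vn par R z; v1 = Vt1 par R z; v2 = Vt2 par R z in
       transpose (rotT R) *v blk
         0
         (vector [1/2 * r * u^2 + 1/2 * d * un^2 - 1/2 * r * u * un
                    + conc (fst z) * (1/2 * (snd zL + snd zR)),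
                  1/2 * r * u * Vt1_star par R zL zR + 1/2 * d * un * v1 - 1/2 * r * u * v1,
                  1/2 * r * u * Vt2_star par R zL zR + 1/2 * d * un * v2 - 1/2 * r * u * v2])
         (rho0 par * (c0 par)^2 * u)))"

text \<open>Wall ghost trace: the normal component of \<open>\<surd>\<rho> U\<close> changes sign.\<close>

definition ghost :: "real^3 \<Rightarrow> trace \<Rightarrow> trace" where
  "ghost n z = (let q = fst z in
     (blk (q $ 1) (vrows q - (2 * (vrows q \<bullet> n)) *\<^sub>R n) (q $ 5), snd z))"

section \<open>The semi-discrete scheme\<close>

record 'e fields =
  fQ :: "'e \<Rightarrow> mindex \<Rightarrow> real^5"
  fG :: "'e \<Rightarrow> mindex \<Rightarrow> real^3^5"
  fmu :: "'e \<Rightarrow> mindex \<Rightarrow> real"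
  fGc :: "'e \<Rightarrow> mindex \<Rightarrow> real^3"

abbreviation Cat :: "'e fields \<Rightarrow> 'e \<Rightarrow> mindex \<Rightarrow> real" where
  "Cat F e p \<equiv> conc (fQ F e p)"

abbreviation Wat :: "params \<Rightarrow> 'e fields \<Rightarrow> 'e \<Rightarrow> mindex \<Rightarrow> real^5" where
  "Wat par F e p \<equiv> Wvar par (fQ F e p) (fmu F e p)"

abbreviation Fvat :: "params \<Rightarrow> 'e fields \<Rightarrow> 'e \<Rightarrow> mindex \<Rightarrow> real^3^5" where
  "Fvat par F e p \<equiv> Fv par (fQ F e p) (fG F e p)"

text \<open>For a node \<open>p\<close> of a local face \<open>l\<close>: the left and the right side of the interface there.
  On a wall the interior element is the left side; there \<open>rside\<close> is not used.\<close>

definition lside :: "'e dg \<Rightarrow> 'e lface \<Rightarrow> mindex \<Rightarrow> 'e lface \<times> mindex" where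
  "lside D l p = (if l \<in> bfaces D \<or> is_left D l then (l, p) else (nbr D l, nmap D l p))"

definition rside :: "'e dg \<Rightarrow> 'e lface \<Rightarrow> mindex \<Rightarrow> 'e lface \<times> mindex" where
  "rside D l p = (if is_left D l then (nbr D l, nmap D l p) else (l, p))"

definition atL :: "'e dg \<Rightarrow> ('e \<Rightarrow> mindex \<Rightarrow> 'a) \<Rightarrow> 'e lface \<Rightarrow> mindex \<Rightarrow> 'a" where
  "atL D g l p = (case lside D l p of (l', p') \<Rightarrow> g (fst l') p')"

definition atR :: "'e dg \<Rightarrow> ('e \<Rightarrow> mindex \<Rightarrow> 'a) \<Rightarrow> 'e lface \<Rightarrow> mindex \<Rightarrow> 'a" where
  "atR D g l p = (case rside D l p of (l', p') \<Rightarrow> g (fst l') p')"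

definition avg ::
  "'e dg \<Rightarrow> ('e \<Rightarrow> mindex \<Rightarrow> 'a::real_vector) \<Rightarrow> 'e lface \<Rightarrow> mindex \<Rightarrow> 'a" where
  "avg D g l p = (1/2) *\<^sub>R (atL D g l p + atR D g l p)"

definition jump ::
  "'e dg \<Rightarrow> ('e \<Rightarrow> mindex \<Rightarrow> 'a::real_vector) \<Rightarrow> 'e lface \<Rightarrow> mindex \<Rightarrow> 'a" where
  "jump D g l p = atR D g l p - atL D g l p"

definition nL :: "'e dg \<Rightarrow> 'e lface \<Rightarrow> mindex \<Rightarrow> real^3" where
  "nL D l p = (case lside D l p of (l', p') \<Rightarrow> nvec D l' p')"

definition frameL :: "'e dg \<Rightarrow> 'e lface \<Rightarrow> mindex \<Rightarrow> real^3^3" where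
  "frameL D l p = (case lside D l p of (l', p') \<Rightarrow> frame D l' p')"

definition sjacL :: "'e dg \<Rightarrow> 'e lface \<Rightarrow> mindex \<Rightarrow> real" where
  "sjacL D l p = (case lside D l p of (l', p') \<Rightarrow> sjac D l' p')"

definition beta :: "'e dg \<Rightarrow> params \<Rightarrow> 'e lface \<Rightarrow> mindex \<Rightarrow> real" where
  "beta D par l p = kappa par * (real (deg D) * (real (deg D) + 1) / 2) * sjacL D l p
                      * avg D (\<lambda>e q. 1 / jac D e q) l p"

definition zown :: "'e fields \<Rightarrow> 'e \<Rightarrow> mindex \<Rightarrow> trace" where
  "zown F e p = (fQ F e p, fmu F e p)"

definition zleft :: "'e dg \<Rightarrow> 'e fields \<Rightarrow> 'e lface \<Rightarrow> mindex \<Rightarrow> trace" where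
  "zleft D F l p = atL D (zown F) l p"

definition zright :: "'e dg \<Rightarrow> 'e fields \<Rightarrow> 'e lface \<Rightarrow> mindex \<Rightarrow> trace" where
  "zright D F l p = (if l \<in> bfaces D then ghost (nvec D l p) (zown F (fst l) p)
                     else atR D (zown F) l p)"

text \<open>The interface quantities seen from the element owning the local face \<open>l\<close>, contracted with
  its own outward normal: for the right element the normal flux with respect to \<open>nL\<close> changes sign.\<close>

definition own_sign :: "'e dg \<Rightarrow> 'e lface \<Rightarrow> real" where
  "own_sign D l = (if l \<in> bfaces D \<or> is_left D l then 1 else -1)"

definition Fe_star_n :: "'e dg \<Rightarrow> params \<Rightarrow> iflux \<Rightarrow> 'e fields \<Rightarrow> 'e lface \<Rightarrow> mindex \<Rightarrow> real^5" where
  "Fe_star_n D par flx F l p =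
     own_sign D l *\<^sub>R Fe_star flx par (frameL D l p) (zleft D F l p) (zright D F l p)"

definition Phi_diamond_n ::
  "'e dg \<Rightarrow> params \<Rightarrow> iflux \<Rightarrow> 'e fields \<Rightarrow> 'e lface \<Rightarrow> mindex \<Rightarrow> real^5" where
  "Phi_diamond_n D par flx F l p =
     own_sign D l *\<^sub>R Phi_diamond flx par (frameL D l p) (zleft D F l p) (zright D F l p)
                       (zown F (fst l) p)"

definition W_star :: "'e dg \<Rightarrow> params \<Rightarrow> 'e fields \<Rightarrow> 'e lface \<Rightarrow> mindex \<Rightarrow> real^5" where
  "W_star D par F l p =
     (if l \<in> bfaces D then
        (case wall_bc D l of
           FreeSlip \<Rightarrow> Wat par F (fst l) p
         | NoSlip \<Rightarrow> blk (fmu F (fst l) p) 0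
                        (pres (fQ F (fst l) p) / (rho0 par * (c0 par)^2)))
      else avg D (Wat par F) l p)"

definition Fv_star_n :: "'e dg \<Rightarrow> params \<Rightarrow> 'e fields \<Rightarrow> 'e lface \<Rightarrow> mindex \<Rightarrow> real^5" where
  "Fv_star_n D par F l p =
     (if l \<in> bfaces D then
        (case wall_bc D l of
           FreeSlip \<Rightarrow> 0
         | NoSlip \<Rightarrow> blk 0 ((2 * eta par (Cat F (fst l) p)) *\<^sub>R
                             (strain (fG F (fst l) p) *v nvec D l p)) 0)
      else bdot (avg D (Fvat par F) l p
                 + blk ((beta D par l p * jump D (fmu F) l p) *\<^sub>R nL D l p) 0 0) (nvec D l p))"

definition C_star :: "'e dg \<Rightarrow> 'e fields \<Rightarrow> 'e lface \<Rightarrow> mindex \<Rightarrow> real" where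
  "C_star D F l p = (if l \<in> bfaces D then Cat F (fst l) p else avg D (Cat F) l p)"

text \<open>On a wall the normal component is the solution of \<open>-3/2 \<sigma> \<epsilon> G\<^sub>c\<^sup>\<star> \<cdot> n = f\<^sub>w'(C)\<close>.\<close>

definition Gc_star_n :: "'e dg \<Rightarrow> params \<Rightarrow> 'e fields \<Rightarrow> 'e lface \<Rightarrow> mindex \<Rightarrow> real" where
  "Gc_star_n D par F l p =
     (if l \<in> bfaces D then - deriv (fw par) (Cat F (fst l) p) / (3/2 * sigma par * eps par)
      else (avg D (fGc F) l p + (beta D par l p * jump D (Cat F) l p) *\<^sub>R nL D l p) \<bullet> nvec D l p)"

definition eq_state ::
  "'e dg \<Rightarrow> params \<Rightarrow> iflux \<Rightarrow> ('e \<Rightarrow> mindex \<Rightarrow> real^5) \<Rightarrow> 'e fields \<Rightarrow> 'e \<Rightarrow> (mindex \<Rightarrow> real^5) \<Rightarrow> bool"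
  where
  "eq_state D par flx Qt F e \<phi> \<longleftrightarrow>
     vinner (deg D) (wgt D) (\<lambda>p. jac D e p *\<^sub>R (mass par (fQ F e p) *v Qt e p)) \<phi>
     + elem_bd_int D e (\<lambda>l p. \<phi> p \<bullet>
         (Fe_star_n D par flx F l p - bdot (Fe par (fQ F e p)) (nvec D l p)
          + (Phi_diamond_n D par flx F l p
             - (\<Sum>m\<in>UNIV. Wat par F e p $ m *\<^sub>R bdot (Phi par (fQ F e p) $ m) (nvec D l p)))))
     + vinner (deg D) (wgt D) \<phi>
         (bdiv (deg D) (node D) (bcontra D e (\<lambda>q. Fe par (fQ F e q))))
     + (\<Sum>m\<in>UNIV. vinner (deg D) (wgt D) \<phi>
         (\<lambda>p. bdot (bcontra D e (\<lambda>q. Phi par (fQ F e q) $ m) p)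
                   (grad (deg D) (node D) (\<lambda>q. Wat par F e q $ m) p)))
     = elem_bd_int D e (\<lambda>l p. \<phi> p \<bullet> Fv_star_n D par F l p)
       - vinner (deg D) (wgt D) (bcontra D e (Fvat par F e)) (bgrad (deg D) (node D) \<phi>)"

definition eq_grad :: "'e dg \<Rightarrow> params \<Rightarrow> 'e fields \<Rightarrow> 'e \<Rightarrow> (mindex \<Rightarrow> real^3^5) \<Rightarrow> bool" where
  "eq_grad D par F e \<phi> \<longleftrightarrow>
     vinner (deg D) (wgt D) (\<lambda>p. jac D e p *\<^sub>R fG F e p) \<phi>
     = elem_bd_int D e (\<lambda>l p. (W_star D par F l p - Wat par F e p) \<bullet> bdot (\<phi> p) (nvec D l p))
       + vinner (deg D) (wgt D) (bcontra D e \<phi>) (bgrad (deg D) (node D) (Wat par F e))"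

definition eq_mu :: "'e dg \<Rightarrow> params \<Rightarrow> 'e fields \<Rightarrow> 'e \<Rightarrow> (mindex \<Rightarrow> real) \<Rightarrow> bool" where
  "eq_mu D par F e \<phi> \<longleftrightarrow>
     vinner (deg D) (wgt D) (\<lambda>p. jac D e p * fmu F e p) \<phi>
     = vinner (deg D) (wgt D) (\<lambda>p. jac D e p * deriv (f0 par) (Cat F e p)) \<phi>
       - elem_bd_int D e (\<lambda>l p. 3/2 * sigma par * eps par * \<phi> p * Gc_star_n D par F l p)
       + vinner (deg D) (wgt D) (\<lambda>p. (3/2 * sigma par * eps par) *\<^sub>R contra D e (fGc F e) p)
           (grad (deg D) (node D) \<phi>)"

definition eq_gradc :: "'e dg \<Rightarrow> 'e fields \<Rightarrow> 'e \<Rightarrow> (mindex \<Rightarrow> real^3) \<Rightarrow> bool" where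
  "eq_gradc D F e \<phi> \<longleftrightarrow>
     vinner (deg D) (wgt D) (\<lambda>p. jac D e p *\<^sub>R fGc F e p) \<phi>
     = elem_bd_int D e (\<lambda>l p. (C_star D F l p - Cat F e p) * (\<phi> p \<bullet> nvec D l p))
       + vinner (deg D) (wgt D) (contra D e \<phi>) (grad (deg D) (node D) (Cat F e))"

definition dg_solution :: "'e dg \<Rightarrow> params \<Rightarrow> iflux \<Rightarrow> real set \<Rightarrow> (real \<Rightarrow> 'e fields) \<Rightarrow> bool" where
  "dg_solution D par flx I sol \<longleftrightarrow>
     (\<forall>t\<in>I. \<forall>e\<in>elems D.
        (\<forall>p\<in>nodes (deg D). (\<lambda>s. fQ (sol s) e p) differentiable (at t within I)) \<and>
        (\<forall>\<phi>. eq_state D par flx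
               (\<lambda>e p. vector_derivative (\<lambda>s. fQ (sol s) e p) (at t within I)) (sol t) e \<phi>) \<and>
        (\<forall>\<phi>. eq_grad D par (sol t) e \<phi>) \<and>
        (\<forall>\<phi>. eq_mu D par (sol t) e \<phi>) \<and>
        (\<forall>\<phi>. eq_gradc D (sol t) e \<phi>))"

section \<open>Discrete entropy\<close>

definition entropy_density :: "params \<Rightarrow> 'e fields \<Rightarrow> 'e \<Rightarrow> mindex \<Rightarrow> real" where
  "entropy_density par F e p =
     f0 par (Cat F e p) + 3/4 * sigma par * eps par * (norm (fGc F e p))^2
     + 1/2 * dens par (fQ F e p) * (norm (vel par (fQ F e p)))^2
     + (pres (fQ F e p))^2 / (2 * rho0 par * (c0 par)^2)"

definition discrete_entropy :: "'e dg \<Rightarrow> params \<Rightarrow> 'e fields \<Rightarrow> real" where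
  "discrete_entropy D par F =
     (\<Sum>e\<in>elems D. vinner (deg D) (wgt D) (\<lambda>p. jac D e p * entropy_density par F e p) (\<lambda>p. 1))
     + 3/4 * sigma par * eps par *
       (\<Sum>l\<in>left_faces D. face_int D l (\<lambda>p. beta D par l p * (jump D (Cat F) l p)^2))"

definition surface_energy :: "'e dg \<Rightarrow> params \<Rightarrow> 'e fields \<Rightarrow> real" where
  "surface_energy D par F = (\<Sum>l\<in>bfaces D. face_int D l (\<lambda>p. fw par (Cat F (fst l) p)))"

definition dissipation :: "'e dg \<Rightarrow> params \<Rightarrow> 'e fields \<Rightarrow> real" where
  "dissipation D par F =
     (\<Sum>e\<in>elems D. vinner (deg D) (wgt D)
        (\<lambda>p. jac D e p * (M0 par * (norm (fG F e p $ 1))^2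
               + 2 * eta par (Cat F e p) * (strain (fG F e p) \<bullet> strain (fG F e p))))
        (\<lambda>p. 1))"

end

(*
  Testing the state equation with the entropy variables W turns the volume terms into face terms:
  the Gauss-Lobatto rule gives summation by parts, and contracting the non-conservative
  coefficient Phi_m with W reproduces row m of the inviscid flux, so no metric identity or chain
  rule is needed. At each face node the two sides together produce zero (central), or, with the
  mass fluxes m_L = rho_L lambda_L^+ and m_R = -rho_R lambda_R^- of the exact Riemann solver,
    (m_R + m/2) (U_nR - U_ns)^2 + (m_L - m/2) (U_nL - U_ns)^2 + |m|/2 |V_tR - V_tL|^2,
    m = rho_s U_ns (star values),  -2 m_R <= m <= 2 m_L.
  The gradient equation tested with the viscous flux gives the physical dissipation. The chemical
  potential is tested with C_t, and the time derivative of the equation for G_c with G_c; this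
  produces the rate of the free energy, of the interface penalty and of the surface energy.
  Adding the two sides of an interface requires its quadrature weights to be invariant under
  reversal of a direction, which follows from uniqueness of the Gauss-Lobatto rule.
*)
theory Submission
  imports Defs
begin

section \<open>The one-dimensional Gauss--Lobatto rule\<close>

text \<open>All nonlinear products are collocated at the nodes, so the algebraic identities between
  fluxes and entropy variables are used node by node and aliasing never enters; the exactness of the
  rule serves only to differentiate by parts and to identify the weights. Differentiability in time
  is the delicate point. The density is a clamped function of C and may have kinks at C = 0 and C =
  1. It is never differentiated: in the state variables the kinetic energy is half the square of
  sqrt(rho) U, and the mass matrix paired with \<open>W\<close> yields exactly its rate. Nor is G_c
  assumed differentiable; its nodal values depend on C linearly with coefficients that are constant
  in time, and inherit a derivative from C. The chemical potential and the gradient \<open>G\<close>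
  enter only algebraically. Derivatives are taken within the time interval, one-sided at its end
  points, so it must be non-degenerate for them to be unique.\<close>

lemma integral_poly_pderiv:
  fixes f :: "real poly"
  shows "integral {-1..1} (poly (pderiv f)) = poly f 1 - poly f (-1)"
proof (rule integral_unique, rule fundamental_theorem_of_calculus)
  show "(poly f has_vector_derivative poly (pderiv f) x) (at x within {-1..1})" for x
    using poly_DERIV[of f x]
    by (simp add: has_real_derivative_iff_has_vector_derivative has_vector_derivative_at_within)
qed simp

lemma integral_poly_pos:
  fixes f :: "real poly"
  assumes "f \<noteq> 0" "\<And>t. t \<in> {-1..1} \<Longrightarrow> 0 \<le> poly f t"
  shows "0 < integral {-1..1} (poly f)"
proof -
  have cont: "continuous_on {-1..1} (poly f)"
    by (intro continuous_intros)
  have "integral {-1..1} (poly f) \<noteq> 0"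
  proof
    assume "integral {-1..1} (poly f) = 0"
    hence "\<forall>t\<in>{-1..1}. poly f t = 0"
      using integral_eq_0_iff[OF cont] assms(2) by auto
    hence "{-1..1} \<subseteq> {t. poly f t = 0}" by auto
    hence "finite {-1..1::real}"
      using poly_roots_finite[OF assms(1)] finite_subset by blast
    thus False using infinite_Icc[of "-1::real" 1] by simp
  qed
  moreover have "0 \<le> integral {-1..1} (poly f)"
    by (rule integral_nonneg) (use cont assms(2) in \<open>auto intro: integrable_continuous_real\<close>)
  ultimately show ?thesis by simp
qed

lemma degree_lagrange:
  assumes "j \<le> N"
  shows "degree (lagrange N x j) \<le> N"
proof -
  have "degree (lagrange N x j)
      \<le> (\<Sum>m\<in>{..N} - {j}. degree (smult (1 / (x j - x m)) [:- x m, 1:]))"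
    unfolding lagrange_def
    using degree_prod_sum_le[of "{..N} - {j}" "\<lambda>m. smult (1 / (x j - x m)) [:- x m, 1:]"]
    by (simp only: o_def finite_Diff finite_atMost simp_thms)
  also have "\<dots> \<le> (\<Sum>m\<in>{..N} - {j}. 1)"
    by (intro sum_mono order_trans[OF degree_smult_le]) simp
  finally show ?thesis using assms by simp
qed

lemma gauss_lobatto_inj:
  assumes "gauss_lobatto N x w"
  shows "inj_on x {..N}"
  using assms strict_mono_on_imp_inj_on unfolding gauss_lobatto_def by blast

lemma gauss_lobatto_exact:
  assumes "gauss_lobatto N x w" "degree f \<le> 2 * N - 1"
  shows "(\<Sum>i\<le>N. w i * poly f (x i)) = integral {-1..1} (poly f)"
  using assms unfolding gauss_lobatto_def by blast

lemma lagrange_node: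
  assumes "gauss_lobatto N x w" "i \<le> N" "j \<le> N"
  shows "poly (lagrange N x j) (x i) = (if i = j then 1 else 0)"
proof (cases "i = j")
  case True
  have "x j - x m \<noteq> 0" if "m \<in> {..N} - {j}" for m
    using gauss_lobatto_inj[OF assms(1)] that assms(3) by (auto simp: inj_on_def)
  hence "poly (smult (1 / (x j - x m)) [:- x m, 1:]) (x j) = 1" if "m \<in> {..N} - {j}" for m
    using that by (simp add: left_diff_distrib[symmetric] diff_divide_distrib[symmetric])
  thus ?thesis unfolding lagrange_def poly_prod True
    by (simp only: prod.neutral_const refl if_True cong: prod.cong)
next
  case False
  thus ?thesis using assms(2) unfolding lagrange_def poly_prod
    by (auto intro!: prod_zero)
qed

lemma gauss_lobatto_range:
  assumes "gauss_lobatto N x w" "i \<le> N"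
  shows "-1 \<le> x i \<and> x i \<le> 1"
    and "0 < i \<Longrightarrow> -1 < x i" and "i < N \<Longrightarrow> x i < 1"
proof -
  have s: "strict_mono_on {..N} x" "x 0 = -1" "x N = 1"
    using assms(1) unfolding gauss_lobatto_def by auto
  show 1: "0 < i \<Longrightarrow> -1 < x i"
    using strict_mono_onD[OF s(1), of 0 i] assms(2) s by auto
  show 2: "i < N \<Longrightarrow> x i < 1"
    using strict_mono_onD[OF s(1), of i N] assms(2) s by auto
  show "-1 \<le> x i \<and> x i \<le> 1"
    using 1 2 s assms(2) by (cases "i = 0"; cases "i = N") auto
qed

text \<open>Exactness for a non-negative polynomial that vanishes at all other nodes isolates the
  weight. Interior nodes enter squared, but end points only to first order, since 1 - t and 1 + t
  keep their sign on [-1,1]; this saving keeps the degree within 2N - 1.\<close>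

lemma gauss_lobatto_weight_pos:
  assumes gl: "gauss_lobatto N x w" and i: "i \<le> N"
  shows "0 < w i"
proof -
  have N: "1 \<le> N" and ends: "x 0 = -1" "x N = 1"
    using gl unfolding gauss_lobatto_def by auto
  define g :: "real poly" where "g = (\<Prod>m\<in>{1..<N} - {i}. [:- x m, 1:])"
  define h :: "real poly" where
    "h = (if i = 0 then [:1, -1:] else if i = N then [:1, 1:] else [:1, 0, -1:])"
  define f where "f = h * g^2"
  have g0: "g \<noteq> 0" unfolding g_def by (simp add: prod_zero_iff)
  have h0: "h \<noteq> 0" unfolding h_def by auto
  have dg: "degree g = card ({1..<N} - {i})"
    unfolding g_def by (subst degree_prod_eq_sum_degree) auto
  have "degree f = degree h + 2 * degree g"
    unfolding f_def using g0 h0 by (simp add: degree_mult_eq degree_power_eq)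
  also have "\<dots> \<le> 2 * N - 1"
  proof (cases "i = 0 \<or> i = N")
    case True
    hence "{1..<N} - {i} = {1..<N}" by auto
    hence "card ({1..<N} - {i}) = N - 1" by simp
    thus ?thesis using N True unfolding dg by (auto simp: h_def)
  next
    case False
    hence "card ({1..<N} - {i}) = N - 2" "2 \<le> N" using i False by (simp_all add: card_Diff_singleton)
    thus ?thesis using False unfolding dg by (simp add: h_def)
  qed
  finally have deg: "degree f \<le> 2 * N - 1" .
  have h_nn: "0 \<le> poly h t" if "t \<in> {-1..1}" for t
  proof -
    have "0 \<le> (1 - t) * (1 + t)" using that by (intro mult_nonneg_nonneg) auto
    thus ?thesis using that unfolding h_def by (auto simp: algebra_simps)
  qed
  have pos: "0 < integral {-1..1} (poly f)"
    by (rule integral_poly_pos) (use g0 h0 h_nn in \<open>auto simp: f_def\<close>)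
  have zero: "poly f (x j) = 0" if "j \<le> N" "j \<noteq> i" for j
  proof (cases "j = 0 \<or> j = N")
    case True
    thus ?thesis using that ends N unfolding f_def h_def by auto
  next
    case False
    hence "j \<in> {1..<N} - {i}" using that by auto
    hence "poly g (x j) = 0" unfolding g_def poly_prod by (auto intro!: prod_zero)
    thus ?thesis by (simp add: f_def)
  qed
  have "(\<Sum>j\<le>N. w j * poly f (x j)) = w i * poly f (x i)"
    using i zero by (subst sum.remove[of _ i]) auto
  hence "0 < w i * poly f (x i)"
    using gauss_lobatto_exact[OF gl deg] pos by simp
  moreover have "0 \<le> poly f (x i)"
    using h_nn gauss_lobatto_range(1)[OF gl i] by (simp add: f_def)
  ultimately show ?thesis by (simp add: zero_less_mult_iff)
qed

text \<open>The monic node polynomials of two such rules share the roots -1 and 1, so they differ by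
  (t^2 - 1) r. Both are orthogonal to r, which forces the integral of r^2 (1 - t^2) to
  vanish.\<close>

lemma gauss_lobatto_unique:
  assumes gx: "gauss_lobatto N x w" and gy: "gauss_lobatto N y v" and i: "i \<le> N"
  shows "x i = y i" and "w i = v i"
proof -
  define P :: "(nat \<Rightarrow> real) \<Rightarrow> real poly" where "P = (\<lambda>z. \<Prod>i\<le>N. [:- z i, 1:])"
  have N: "1 \<le> N" using gx unfolding gauss_lobatto_def by auto
  have dP: "degree (P z) = Suc N" for z
    unfolding P_def by (subst degree_prod_eq_sum_degree) auto
  have lP: "coeff (P z) (Suc N) = 1" for z
    using lead_coeff_prod[of "\<lambda>i. [:- z i, 1:]" "{..N}"] dP[of z] by (simp add: P_def)
  have rP: "poly (P z) t = 0 \<longleftrightarrow> t \<in> z ` {..N}" for z t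
    unfolding P_def poly_prod by (auto simp: prod_zero_iff)
  have ends: "-1 \<in> z ` {..N} \<and> 1 \<in> z ` {..N}" if "gauss_lobatto N z u" for z u
  proof -
    have "z 0 = -1" "z N = 1" using that unfolding gauss_lobatto_def by auto
    thus ?thesis by (metis atMost_iff imageI le0 order_refl)
  qed
  have "P x = P y"
  proof (rule ccontr)
    define d where "d = P x - P y"
    assume "P x \<noteq> P y"
    hence d0: "d \<noteq> 0" by (simp add: d_def)
    have "degree d \<le> Suc N"
      unfolding d_def by (rule degree_diff_le) (simp_all add: dP)
    moreover have "coeff d (Suc N) = 0" by (simp add: d_def lP)
    ultimately have dd: "degree d \<le> N"
      using d0 by (metis le_SucE leading_coeff_0_iff)
    have "poly (P x) 1 = 0" "poly (P y) 1 = 0" "poly (P x) (-1) = 0" "poly (P y) (-1) = 0"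
      unfolding rP using ends[OF gx] ends[OF gy] by blast+
    hence "poly d 1 = 0" "poly d (-1) = 0" by (simp_all add: d_def)
    then obtain r where r: "d = [:-1, 0, 1:] * r"
    proof -
      from \<open>poly d 1 = 0\<close> obtain s where s: "d = [:-1, 1:] * s"
        by (auto simp: poly_eq_0_iff_dvd)
      with \<open>poly d (-1) = 0\<close> have "poly s (-1) = 0" by simp
      then obtain u where "s = [:1, 1:] * u"
        by (auto simp: poly_eq_0_iff_dvd)
      hence "d = [:-1, 0, 1:] * u" using s by (simp add: algebra_simps)
      thus ?thesis using that by blast
    qed
    have r0: "r \<noteq> 0" using d0 r by auto
    have "degree d = 2 + degree r"
      unfolding r using r0 by (subst degree_mult_eq) auto
    hence dr: "degree r + Suc N \<le> 2 * N - 1" using dd by simp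
    \<comment> \<open>The monic leading terms cancel in \<open>d\<close>, so r has degree at most N
      - 2 and \<open>r * P z\<close> at most 2N - 1. The rule is then exact, and it samples only
      roots of \<open>P z\<close>.\<close>
    have orth: "integral {-1..1} (poly (r * P z)) = 0" if "gauss_lobatto N z u" for z u
    proof -
      have "degree (r * P z) \<le> 2 * N - 1"
        using degree_mult_le[of r "P z"] dP[of z] dr by simp
      from gauss_lobatto_exact[OF that this]
      have "integral {-1..1} (poly (r * P z)) = (\<Sum>i\<le>N. u i * poly (r * P z) (z i))" by simp
      also have "\<dots> = 0" using rP[of z] by (intro sum.neutral) auto
      finally show ?thesis .
    qed
    have int: "poly q integrable_on {-1..1}" for q :: "real poly"
      by (intro integrable_continuous_real continuous_intros)
    have "integral {-1..1} (poly (r^2 * [:1, 0, -1:]))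
        = integral {-1..1} (\<lambda>t. poly (r * P y) t - poly (r * P x) t)"
    proof (rule integral_cong)
      fix t :: real
      have "poly (P x) t - poly (P y) t = poly [:-1, 0, 1:] t * poly r t"
        using r unfolding d_def by (metis poly_diff poly_mult)
      hence "poly (P y) t - poly (P x) t = - (poly [:-1, 0, 1:] t * poly r t)"
        by (metis minus_diff_eq)
      hence "poly r t * (poly (P y) t - poly (P x) t) = poly r t * - (poly [:-1, 0, 1:] t * poly r t)"
        by metis
      thus "poly (r^2 * [:1, 0, -1:]) t = poly (r * P y) t - poly (r * P x) t"
        by (simp add: algebra_simps power2_eq_square)
    qed
    also have "\<dots> = 0"
      by (subst integral_diff) (simp_all add: int orth[OF gx] orth[OF gy])
    finally have "integral {-1..1} (poly (r^2 * [:1, 0, -1:])) = 0" .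
    moreover have "0 < integral {-1..1} (poly (r^2 * [:1, 0, -1:]))"
    proof (rule integral_poly_pos)
      fix t :: real assume "t \<in> {-1..1}"
      hence "0 \<le> (1 - t) * (1 + t)" by (intro mult_nonneg_nonneg) auto
      hence "0 \<le> poly r t ^ 2 * ((1 - t) * (1 + t))" by simp
      also have "\<dots> = poly (r^2 * [:1, 0, -1:]) t"
        by (simp add: algebra_simps power2_eq_square)
      finally show "0 \<le> poly (r^2 * [:1, 0, -1:]) t" .
    next
      show "r\<^sup>2 * [:1, 0, -1:] \<noteq> 0" using r0 by (simp del: mult_pCons_right)
    qed
    ultimately show False by simp
  qed
  hence img: "x ` {..N} = y ` {..N}" by (intro set_eqI) (simp only: rP[symmetric])
  \<comment> \<open>Equal root sets become equal indexed nodes because a finite set has only one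
    strictly increasing enumeration.\<close>
  have srt: "sorted (map z [0..<Suc N]) \<and> distinct (map z [0..<Suc N])"
    if "gauss_lobatto N z u" for z u
  proof
    have "strict_mono_on {..N} z" using that unfolding gauss_lobatto_def by blast
    hence "z i \<le> z j" if "i \<le> j" "j \<le> N" for i j
      using strict_mono_on_leD that by fastforce
    thus "sorted (map z [0..<Suc N])"
      by (simp add: sorted_iff_nth_mono del: upt_Suc)
    show "distinct (map z [0..<Suc N])"
      using gauss_lobatto_inj[OF that]
      by (simp only: distinct_map distinct_upt set_upt atLeast0LessThan lessThan_Suc_atMost simp_thms)
  qed
  have "set (map x [0..<Suc N]) = set (map y [0..<Suc N])"
    using img by (simp only: set_map set_upt atLeast0LessThan lessThan_Suc_atMost)
  hence "map x [0..<Suc N] = map y [0..<Suc N]"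
    using srt[OF gx] srt[OF gy] sorted_distinct_set_unique by blast
  hence xy: "x j = y j" if "j \<le> N" for j
    using that by (simp add: map_eq_conv del: upt_Suc)
  show "x i = y i" using xy i .
  have weight: "u i = integral {-1..1} (poly (lagrange N z i))" if "gauss_lobatto N z u" for z u
  proof -
    have "degree (lagrange N z i) \<le> 2 * N - 1" using degree_lagrange[OF i, of z] N by linarith
    from gauss_lobatto_exact[OF that this]
    have "integral {-1..1} (poly (lagrange N z i)) = (\<Sum>j\<le>N. if j = i then u j else 0)"
      using lagrange_node[OF that _ i] i by (simp add: if_distrib cong: if_cong)
    thus ?thesis using i by (simp add: sum.delta)
  qed
  have "lagrange N x i = lagrange N y i"
    unfolding lagrange_def using i xy by (intro prod.cong) auto
  thus "w i = v i" using weight[OF gx] weight[OF gy] by simp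
qed

text \<open>The rule reflected by t -> -t, renumbered by i -> N - i so that its nodes increase
  again, meets the same defining conditions.\<close>

lemma gauss_lobatto_weight_sym:
  assumes gl: "gauss_lobatto N x w" and i: "i \<le> N"
  shows "w (N - i) = w i"
proof -
  have s: "strict_mono_on {..N} x" using gl unfolding gauss_lobatto_def by blast
  have "gauss_lobatto N (\<lambda>i. - x (N - i)) (\<lambda>i. w (N - i))"
    unfolding gauss_lobatto_def
  proof (intro conjI allI impI)
    show "strict_mono_on {..N} (\<lambda>i. - x (N - i))"
    proof (rule strict_mono_onI)
      fix a b assume "a \<in> {..N}" "b \<in> {..N}" "a < b"
      thus "- x (N - a) < - x (N - b)"
        using strict_mono_onD[OF s, of "N - b" "N - a"] by simp
    qed
    fix f :: "real poly" assume "degree f \<le> 2 * N - 1"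
    hence deg: "degree (pcompose f [:0, -1:]) \<le> 2 * N - 1" by (simp add: degree_pcompose)
    have reflected: "poly (pcompose f [:0, -1:]) = (\<lambda>t. poly f (- t))"
      by (simp add: fun_eq_iff poly_pcompose)
    have "(\<Sum>i\<le>N. w (N - i) * poly f (- x (N - i))) = (\<Sum>i\<le>N. w i * poly f (- x i))"
      using sum.atLeastAtMost_rev[of "\<lambda>i. w i * poly f (- x i)" 0 N]
      by (simp only: atMost_atLeast0 add_0_right)
    also have "\<dots> = integral {-1..1} (\<lambda>t. poly f (- t))"
      using gauss_lobatto_exact[OF gl deg] unfolding reflected .
    also have "\<dots> = integral {-1..1} (poly f)"
      using Henstock_Kurzweil_Integration.integral_reflect_real[of 1 "-1" "poly f"] by (simp only: minus_minus)
    finally show "(\<Sum>i\<le>N. w (N - i) * poly f (- x (N - i))) = integral {-1..1} (poly f)" .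
  next
    have "1 \<le> N" "x 0 = -1" "x N = 1" using gl unfolding gauss_lobatto_def by blast+
    thus "1 \<le> N" "- x (N - 0) = -1" "- x (N - N) = 1" by simp_all
  qed
  from gauss_lobatto_unique(2)[OF gl this i] show ?thesis by simp
qed

text \<open>Exactness is applied to the derivative of \<open>?l i * ?l j\<close>, whose degree is at
  most 2N - 1, the limit of the rule. The Lagrange polynomials being cardinal leaves one term in
  each sum; the right side is the boundary matrix diag(-1, 0, ..., 0, 1).\<close>

lemma gauss_lobatto_sbp:
  assumes gl: "gauss_lobatto N x w" and i: "i \<le> N" and j: "j \<le> N"
  shows "w i * poly (pderiv (lagrange N x j)) (x i) + w j * poly (pderiv (lagrange N x i)) (x j)
       = (if i = N \<and> j = N then 1 else 0) - (if i = 0 \<and> j = 0 then 1 else 0)"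
proof -
  let ?l = "lagrange N x"
  have ends: "x 0 = -1" "x N = 1" using gl unfolding gauss_lobatto_def by auto
  have "degree (pderiv (?l i * ?l j)) \<le> 2 * N - 1"
    using degree_pderiv[of "?l i * ?l j"] degree_mult_le[of "?l i" "?l j"]
      degree_lagrange[OF i, of x] degree_lagrange[OF j, of x] by linarith
  from gauss_lobatto_exact[OF gl this]
  have "(\<Sum>k\<le>N. w k * poly (pderiv (?l i * ?l j)) (x k))
      = poly (?l i * ?l j) (x N) - poly (?l i * ?l j) (x 0)"
    by (simp only: integral_poly_pderiv ends)
  also have "(\<Sum>k\<le>N. w k * poly (pderiv (?l i * ?l j)) (x k))
      = (\<Sum>k\<le>N. (if k = i then w k * poly (pderiv (?l j)) (x k) else 0)
               + (if k = j then w k * poly (pderiv (?l i)) (x k) else 0))"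
    by (intro sum.cong)
       (auto simp: pderiv_mult lagrange_node[OF gl _ i] lagrange_node[OF gl _ j] algebra_simps)
  also have "\<dots> = w i * poly (pderiv (?l j)) (x i) + w j * poly (pderiv (?l i)) (x j)"
    using i j by (simp add: sum.distrib sum.delta)
  finally show ?thesis
    using lagrange_node[OF gl _ i] lagrange_node[OF gl _ j] by (auto split: if_splits)
qed

section \<open>Summation by parts on the reference cube\<close>

abbreviation weight :: "(nat \<Rightarrow> real) \<Rightarrow> mindex \<Rightarrow> real" where
  "weight w p \<equiv> \<Prod>d\<in>UNIV. w (p d)"

lemma finite_nodes [simp]: "finite (nodes N)"
proof -
  have "nodes N = PiE UNIV (\<lambda>_. {..N})"
    by (auto simp: nodes_def PiE_def Pi_def)
  thus ?thesis by (simp add: finite_PiE)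
qed

lemma nodes_fun_upd: "p \<in> nodes N \<Longrightarrow> m \<le> N \<Longrightarrow> p(d := m) \<in> nodes N"
  by (simp add: nodes_def)

lemma nodes_le: "p \<in> nodes N \<Longrightarrow> p d \<le> N"
  by (simp add: nodes_def)

text \<open>A pair \<open>(p, m)\<close> encodes two nodes \<open>p\<close> and
  \<open>p(d := m)\<close> on one grid line; exchanging them is the involution
  \<open>?s\<close>.\<close>

lemma sum_nodes_line_swap:
  "(\<Sum>p\<in>nodes N. \<Sum>m\<le>N. h p (p(d := m))) = (\<Sum>p\<in>nodes N. \<Sum>m\<le>N. h (p(d := m)) p)"
proof -
  let ?s = "\<lambda>(p :: mindex, m). (p(d := m), p d)"
  have "(\<Sum>(p, m)\<in>nodes N \<times> {..N}. h p (p(d := m)))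
      = (\<Sum>(p, m)\<in>nodes N \<times> {..N}. h (p(d := m)) p)"
    by (rule sum.reindex_bij_witness[of _ ?s ?s]) (auto simp: nodes_fun_upd nodes_le)
  thus ?thesis by (simp add: sum.cartesian_product)
qed

text \<open>The one-dimensional identity holds on every grid line in direction \<open>d\<close>. The
  remaining weights \<open>W\<close> are constant along the line and become the face
  weights.\<close>

lemma pd_sbp:
  fixes u v :: "mindex \<Rightarrow> real"
  assumes gl: "gauss_lobatto N x w"
  shows "(\<Sum>p\<in>nodes N. weight w p * (u p * pd N x d v p))
       + (\<Sum>p\<in>nodes N. weight w p * (v p * pd N x d u p))
       = (\<Sum>p\<in>{p \<in> nodes N. p d = N}. (\<Prod>k\<in>UNIV - {d}. w (p k)) * (u p * v p))
       - (\<Sum>p\<in>{p \<in> nodes N. p d = 0}. (\<Prod>k\<in>UNIV - {d}. w (p k)) * (u p * v p))"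
proof -
  define W where "W = (\<lambda>p :: mindex. \<Prod>k\<in>UNIV - {d}. w (p k))"
  define l' where "l' = (\<lambda>m. poly (pderiv (lagrange N x m)))"
  have W: "weight w p = w (p d) * W p" for p
    unfolding W_def by (rule prod.remove) auto
  have W_upd: "W (p(d := m)) = W p" for p m
    unfolding W_def by (rule prod.cong) auto
  have sbp: "w i * l' j (x i) + w j * l' i (x j)
      = (if i = N \<and> j = N then 1 else 0) - (if i = 0 \<and> j = 0 then 1 else 0)"
    if "i \<le> N" "j \<le> N" for i j
    unfolding l'_def by (rule gauss_lobatto_sbp[OF gl that])
  have "(\<Sum>p\<in>nodes N. weight w p * (u p * pd N x d v p))
      = (\<Sum>p\<in>nodes N. \<Sum>m\<le>N. W p * u p * v (p(d := m)) * (w (p d) * l' m (x (p d))))"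
    unfolding pd_def W l'_def by (simp add: sum_distrib_left mult_ac)
  moreover have "(\<Sum>p\<in>nodes N. weight w p * (v p * pd N x d u p))
      = (\<Sum>p\<in>nodes N. \<Sum>m\<le>N. W p * u p * v (p(d := m)) * (w m * l' (p d) (x m)))"
  proof -
    \<comment> \<open>Exchanging the two ends of the line makes this sum carry the same factor
      \<open>u p * v (p(d := m))\<close> as the first one, so that the derivative entries can be
      added.\<close>
    have "(\<Sum>p\<in>nodes N. weight w p * (v p * pd N x d u p))
        = (\<Sum>p\<in>nodes N. \<Sum>m\<le>N.
             W p * u (p(d := m)) * v p * (w (p d) * l' ((p(d := m)) d) (x (p d))))"
      unfolding pd_def W l'_def by (simp add: sum_distrib_left mult_ac)
    also have "\<dots> = (\<Sum>p\<in>nodes N. \<Sum>m\<le>N.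
        W (p(d := m)) * u p * v (p(d := m)) * (w ((p(d := m)) d) * l' (p d) (x ((p(d := m)) d))))"
      by (rule sum_nodes_line_swap[of "\<lambda>p q. W p * u q * v p * (w (p d) * l' (q d) (x (p d)))"])
    finally show ?thesis by (simp add: W_upd)
  qed
  ultimately have "(\<Sum>p\<in>nodes N. weight w p * (u p * pd N x d v p))
       + (\<Sum>p\<in>nodes N. weight w p * (v p * pd N x d u p))
       = (\<Sum>p\<in>nodes N. \<Sum>m\<le>N. W p * u p * v (p(d := m)) *
            (w (p d) * l' m (x (p d)) + w m * l' (p d) (x m)))"
    by (simp add: sum.distrib distrib_left)
  \<comment> \<open>Off the diagonal the derivative entries cancel; on it \<open>p(d := m)\<close>
    is \<open>p\<close>, and only the two end points contribute.\<close>
  also have "\<dots> = (\<Sum>p\<in>nodes N. \<Sum>m\<le>N.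
      (if m = N then (if p d = N then W p * (u p * v p) else 0) else 0)
      - (if m = 0 then (if p d = 0 then W p * (u p * v p) else 0) else 0))"
  proof (intro sum.cong refl)
    fix p m assume p: "p \<in> nodes N" and m: "m \<in> {..N}"
    show "W p * u p * v (p(d := m)) * (w (p d) * l' m (x (p d)) + w m * l' (p d) (x m))
        = (if m = N then (if p d = N then W p * (u p * v p) else 0) else 0)
        - (if m = 0 then (if p d = 0 then W p * (u p * v p) else 0) else 0)"
    proof (cases "p d = m")
      case True
      hence "p(d := m) = p" by auto
      thus ?thesis using sbp[of "p d" m] nodes_le[OF p] m True by simp
    next
      case False
      thus ?thesis using sbp[of "p d" m] nodes_le[OF p] m by auto
    qed
  qed
  also have "\<dots> = (\<Sum>p\<in>nodes N. if p d = N then W p * (u p * v p) else 0)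
      - (\<Sum>p\<in>nodes N. if p d = 0 then W p * (u p * v p) else 0)"
    by (simp add: sum_subtractf)
  also have "\<dots> = (\<Sum>p\<in>{p \<in> nodes N. p d = N}. W p * (u p * v p))
      - (\<Sum>p\<in>{p \<in> nodes N. p d = 0}. W p * (u p * v p))"
    by (simp add: sum.inter_filter)
  finally show ?thesis by (simp only: W_def)
qed

section \<open>Linearity of the face quadratures\<close>

lemma face_int_add:
  "face_int D l (\<lambda>p. f p + g p) = face_int D l f + face_int D l g"
  by (simp add: face_int_def distrib_left sum.distrib)

lemma face_int_cmult: "face_int D l (\<lambda>p. c * f p) = c * face_int D l f"
  by (simp add: face_int_def sum_distrib_left mult_ac)

lemma face_int_sum: "face_int D l (\<lambda>p. \<Sum>r\<in>A. f r p) = (\<Sum>r\<in>A. face_int D l (f r))"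
  unfolding face_int_def by (subst sum.swap) (simp add: sum_distrib_left)

lemma face_int_cong:
  "(\<And>p. p \<in> face_nodes D l \<Longrightarrow> f p = g p) \<Longrightarrow> face_int D l f = face_int D l g"
  unfolding face_int_def by (intro sum.cong) auto

lemma elem_bd_int_faces:
  "elem_bd_int D e g
    = (\<Sum>d\<in>UNIV. face_int D (e, d, True) (g (e, d, True)) + face_int D (e, d, False) (g (e, d, False)))"
  unfolding elem_bd_int_def UNIV_Times_UNIV[symmetric]
  by (subst sum.cartesian_product[symmetric]) (simp add: UNIV_bool add.commute)

lemma elem_bd_int_add:
  "elem_bd_int D e (\<lambda>l p. f l p + g l p) = elem_bd_int D e f + elem_bd_int D e g"
  unfolding elem_bd_int_def
  by (simp add: face_int_add sum.distrib case_prod_unfold)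

lemma elem_bd_int_cmult: "elem_bd_int D e (\<lambda>l p. c * f l p) = c * elem_bd_int D e f"
  unfolding elem_bd_int_def
  by (simp add: face_int_cmult sum_distrib_left case_prod_unfold)

lemma elem_bd_int_sum:
  "elem_bd_int D e (\<lambda>l p. \<Sum>r\<in>A. f r l p) = (\<Sum>r\<in>A. elem_bd_int D e (f r))"
  unfolding elem_bd_int_def face_int_sum case_prod_unfold by (rule sum.swap)

lemma elem_bd_int_cong:
  "(\<And>d s p. p \<in> face_nodes D (e, d, s) \<Longrightarrow> f (e, d, s) p = g (e, d, s) p)
    \<Longrightarrow> elem_bd_int D e f = elem_bd_int D e g"
  unfolding elem_bd_int_def by (intro sum.cong refl) (auto intro!: face_int_cong)

lemma vinner_one: "vinner N w f (\<lambda>_. 1) = (\<Sum>p\<in>nodes N. weight w p * f p)"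
  for f :: "mindex \<Rightarrow> real"
  by (simp add: vinner_def)

lemma vinner_component:
  fixes f g :: "mindex \<Rightarrow> ('a::real_inner)^'n"
  shows "vinner N w f g = (\<Sum>r\<in>UNIV. vinner N w (\<lambda>p. f p $ r) (\<lambda>p. g p $ r))"
  unfolding vinner_def inner_vec_def sum_distrib_left by (rule sum.swap)

section \<open>Quadrature on the mesh\<close>

locale mesh =
  fixes \<Omega> :: "(real^3) set" and D :: "'e dg"
  assumes mesh: "dg_mesh \<Omega> D"
begin

lemma gl: "gauss_lobatto (deg D) (node D) (wgt D)"
  and finite_elems [simp]: "finite (elems D)"
  and jac_pos: "e \<in> elems D \<Longrightarrow> p \<in> nodes (deg D) \<Longrightarrow> 0 < jac D e p"
  and sjac_pos: "l \<in> lfaces D \<Longrightarrow> p \<in> face_nodes D l \<Longrightarrow> 0 < sjac D l p"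
  and bfaces_lfaces: "bfaces D \<subseteq> lfaces D"
  using mesh unfolding dg_mesh_def by auto

lemma wgt_pos: "i \<le> deg D \<Longrightarrow> 0 < wgt D i"
  by (rule gauss_lobatto_weight_pos[OF gl])

lemma weight_pos: "p \<in> nodes (deg D) \<Longrightarrow> 0 < weight (wgt D) p"
  by (auto intro!: prod_pos wgt_pos nodes_le)

lemma face_nodes_nodes: "p \<in> face_nodes D l \<Longrightarrow> p \<in> nodes (deg D)"
  by (auto simp: face_nodes_def split: prod.splits)

lemma finite_face_nodes [simp]: "finite (face_nodes D l)"
  by (rule finite_subset[of _ "nodes (deg D)"]) (auto dest: face_nodes_nodes)

lemma fweight_pos: "p \<in> face_nodes D l \<Longrightarrow> 0 < fweight D l p"
  by (auto simp: fweight_def split: prod.splits intro!: prod_pos wgt_pos nodes_le dest!: face_nodes_nodes)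

lemma lface_elem: "l \<in> lfaces D \<Longrightarrow> fst l \<in> elems D"
  by (auto simp: lfaces_def)

lemma face_int_nonneg:
  assumes "l \<in> lfaces D" "\<And>p. p \<in> face_nodes D l \<Longrightarrow> 0 \<le> f p"
  shows "0 \<le> face_int D l f"
  unfolding face_int_def
  using assms(2) fweight_pos[THEN less_imp_le] sjac_pos[OF assms(1), THEN less_imp_le]
  by (intro sum_nonneg mult_nonneg_nonneg)

text \<open>The surface Jacobian times the outward normal is, up to the sign of the side, the metric
  row \<open>d\<close>. The norm cancels, and the boundary terms of \<open>pd_sbp\<close> are
  physical fluxes for an arbitrary nodal \<open>H\<close>.\<close>

lemma vinner_div_contra:
  fixes u :: "mindex \<Rightarrow> real"
  assumes e: "e \<in> elems D"
  shows "vinner (deg D) (wgt D) u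
           (\<lambda>p. \<Sum>d\<in>UNIV. pd (deg D) (node D) d (\<lambda>q. contra D e H q $ d) p)
       + vinner (deg D) (wgt D) (contra D e H) (grad (deg D) (node D) u)
       = elem_bd_int D e (\<lambda>l p. u p * (H p \<bullet> nvec D l p))"
proof -
  let ?N = "deg D" and ?x = "node D" and ?w = "wgt D"
  have "vinner ?N ?w u (\<lambda>p. \<Sum>d\<in>UNIV. pd ?N ?x d (\<lambda>q. contra D e H q $ d) p)
      = (\<Sum>d\<in>UNIV. \<Sum>p\<in>nodes ?N. weight ?w p * (u p * pd ?N ?x d (\<lambda>q. contra D e H q $ d) p))"
    unfolding vinner_def inner_real_def sum_distrib_left by (rule sum.swap)
  moreover have "vinner ?N ?w (contra D e H) (grad ?N ?x u)
      = (\<Sum>d\<in>UNIV. \<Sum>p\<in>nodes ?N. weight ?w p * (contra D e H p $ d * pd ?N ?x d u p))"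
    unfolding vinner_def inner_vec_def inner_real_def sum_distrib_left grad_def vec_lambda_beta
    by (rule sum.swap)
  moreover have "(\<Sum>p\<in>nodes ?N. weight ?w p * (u p * pd ?N ?x d (\<lambda>q. contra D e H q $ d) p))
      + (\<Sum>p\<in>nodes ?N. weight ?w p * (contra D e H p $ d * pd ?N ?x d u p))
      = face_int D (e, d, True) (\<lambda>p. u p * (H p \<bullet> nvec D (e, d, True) p))
      + face_int D (e, d, False) (\<lambda>p. u p * (H p \<bullet> nvec D (e, d, False) p))" for d
  proof -
    have flux: "sjac D (e, d, s) p * (u p * (H p \<bullet> nvec D (e, d, s) p))
        = (if s then 1 else -1) * (u p * contra D e H p $ d)" if "p \<in> face_nodes D (e, d, s)" for s p
    proof -
      have "0 < norm (metric D e p $ d)"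
        using sjac_pos[of "(e, d, s)" p] that e by (auto simp: lfaces_def sjac_def)
      thus ?thesis
        by (auto simp: sjac_def nvec_def contra_def matrix_vector_mul_component inner_commute)
    qed
    have "face_int D (e, d, s) (\<lambda>p. u p * (H p \<bullet> nvec D (e, d, s) p))
        = (if s then 1 else -1) * (\<Sum>p\<in>face_nodes D (e, d, s).
            (\<Prod>k\<in>UNIV - {d}. ?w (p k)) * (u p * contra D e H p $ d))" for s
      unfolding face_int_def sum_distrib_left
      by (intro sum.cong) (simp_all add: flux mult.assoc fweight_def)
    from this[of True] this[of False] pd_sbp[OF gl, of u d "\<lambda>q. contra D e H q $ d"]
    show ?thesis by (simp add: face_nodes_def)
  qed
  moreover have "elem_bd_int D e (\<lambda>l p. u p * (H p \<bullet> nvec D l p))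
      = (\<Sum>d\<in>UNIV. face_int D (e, d, True) (\<lambda>p. u p * (H p \<bullet> nvec D (e, d, True) p))
      + face_int D (e, d, False) (\<lambda>p. u p * (H p \<bullet> nvec D (e, d, False) p)))"
    by (rule elem_bd_int_faces)
  ultimately show ?thesis by (simp add: sum.distrib[symmetric])
qed

lemma vinner_bdiv_bcontra:
  fixes \<phi> :: "mindex \<Rightarrow> real^5"
  assumes e: "e \<in> elems D"
  shows "vinner (deg D) (wgt D) \<phi> (bdiv (deg D) (node D) (bcontra D e H))
       + vinner (deg D) (wgt D) (bcontra D e H) (bgrad (deg D) (node D) \<phi>)
       = elem_bd_int D e (\<lambda>l p. \<phi> p \<bullet> bdot (H p) (nvec D l p))"
proof -
  have "vinner (deg D) (wgt D) \<phi> (bdiv (deg D) (node D) (bcontra D e H))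
       + vinner (deg D) (wgt D) (bcontra D e H) (bgrad (deg D) (node D) \<phi>)
    = (\<Sum>r\<in>UNIV. vinner (deg D) (wgt D) (\<lambda>p. \<phi> p $ r)
           (\<lambda>p. \<Sum>d\<in>UNIV. pd (deg D) (node D) d (\<lambda>q. contra D e (\<lambda>p. H p $ r) q $ d) p)
       + vinner (deg D) (wgt D) (contra D e (\<lambda>p. H p $ r))
           (grad (deg D) (node D) (\<lambda>p. \<phi> p $ r)))"
    unfolding vinner_component[where 'n = 5] sum.distrib
    by (simp add: bdiv_def bcontra_def bgrad_def contra_def[abs_def])
  also have "\<dots> = elem_bd_int D e (\<lambda>l p. \<phi> p \<bullet> bdot (H p) (nvec D l p))"
    unfolding vinner_div_contra[OF e] elem_bd_int_sum[symmetric]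
    by (simp add: inner_vec_def[of "_ :: real^5"] bdot_def)
  finally show ?thesis .
qed

section \<open>Pairing the two sides of an interior face\<close>

lemma interior_face:
  assumes "l \<in> lfaces D - bfaces D"
  shows "nbr D l \<in> lfaces D - bfaces D" "nbr D (nbr D l) = l"
    and "is_left D (nbr D l) = (\<not> is_left D l)" "grid_match D l (nbr D l) (nmap D l)"
  using assms mesh unfolding dg_mesh_def by blast+

lemma interior_face_node:
  assumes "l \<in> lfaces D - bfaces D" "p \<in> face_nodes D l"
  shows "nmap D (nbr D l) (nmap D l p) = p"
    and "sjac D (nbr D l) (nmap D l p) = sjac D l p"
    and "nvec D (nbr D l) (nmap D l p) = - nvec D l p"
    and "nmap D l p \<in> face_nodes D (nbr D l)"
  using assms interior_face(4)[OF assms(1)] mesh unfolding dg_mesh_def grid_match_def by blast+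

text \<open>A symmetry of the square grid permutes the tangential directions, which leaves the
  product unchanged, and reverses some of them, which is harmless by
  \<open>gauss_lobatto_weight_sym\<close>.\<close>

lemma fweight_nmap:
  assumes l: "l \<in> lfaces D - bfaces D" and p: "p \<in> face_nodes D l"
  shows "fweight D (nbr D l) (nmap D l p) = fweight D l p"
proof -
  obtain e d s where ld: "l = (e, d, s)" by (cases l)
  obtain e' d' s' where nd: "nbr D l = (e', d', s')" by (cases "nbr D l")
  obtain \<pi> r where \<pi>: "bij \<pi>" "\<pi> d = d'"
    and \<tau>: "\<And>k. k \<noteq> d \<Longrightarrow> nmap D l p (\<pi> k) = (if r k then deg D - p k else p k)"
    using interior_face(4)[OF l] p unfolding grid_match_def ld nd[unfolded ld] by auto
  have "bij_betw \<pi> (UNIV - {d}) (UNIV - {d'})"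
    using \<pi> by (auto simp: bij_betw_def inj_on_def bij_def)
  hence "fweight D (nbr D l) (nmap D l p) = (\<Prod>k\<in>UNIV - {d}. wgt D (nmap D l p (\<pi> k)))"
    unfolding nd fweight_def split_conv
    using prod.reindex_bij_betw[of \<pi> "UNIV - {d}" "UNIV - {d'}" "\<lambda>k. wgt D (nmap D l p k)"]
    by simp
  also have "\<dots> = (\<Prod>k\<in>UNIV - {d}. wgt D (p k))"
    using \<tau> gauss_lobatto_weight_sym[OF gl nodes_le[OF face_nodes_nodes[OF p]]]
    by (intro prod.cong) auto
  finally show ?thesis by (simp add: ld fweight_def)
qed

lemma face_int_nbr:
  assumes l: "l \<in> lfaces D - bfaces D"
  shows "face_int D (nbr D l) h = face_int D l (\<lambda>p. h (nmap D l p))"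
  unfolding face_int_def
proof (rule sum.reindex_bij_witness[of _ "nmap D l" "nmap D (nbr D l)"])
  fix p assume p: "p \<in> face_nodes D (nbr D l)"
  have l': "nbr D l \<in> lfaces D - bfaces D" using interior_face(1)[OF l] .
  have ll: "nbr D (nbr D l) = l" using interior_face(2)[OF l] .
  let ?q = "nmap D (nbr D l) p"
  show "nmap D l ?q = p" using interior_face_node(1)[OF l' p] ll by simp
  show "?q \<in> face_nodes D l" using interior_face_node(4)[OF l' p] ll by simp
  thus "fweight D l ?q * sjac D l ?q * h (nmap D l ?q)
      = fweight D (nbr D l) p * sjac D (nbr D l) p * h p"
    using interior_face_node(2)[OF l' p] fweight_nmap[OF l' p] \<open>nmap D l ?q = p\<close> ll by simp
next
  fix p assume p: "p \<in> face_nodes D l"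
  show "nmap D (nbr D l) (nmap D l p) = p" "nmap D l p \<in> face_nodes D (nbr D l)"
    using interior_face_node[OF l p] by auto
qed

lemma finite_lfaces [simp]: "finite (lfaces D)"
  by (simp add: lfaces_def)

lemma finite_left_faces [simp]: "finite (left_faces D)"
  by (rule finite_subset[OF _ finite_lfaces]) (auto simp: left_faces_def)

lemma finite_bfaces [simp]: "finite (bfaces D)"
  by (rule finite_subset[OF bfaces_lfaces finite_lfaces])

text \<open>The involution \<open>nbr\<close> pairs each left local face with a right one. Pulling
  the right contribution back to the left nodes lets the entropy argument be carried out at single
  face nodes.\<close>

lemma sum_elem_bd_int:
  "(\<Sum>e\<in>elems D. elem_bd_int D e g)
    = (\<Sum>l\<in>bfaces D. face_int D l (g l))
    + (\<Sum>l\<in>left_faces D. face_int D l (\<lambda>p. g l p + g (nbr D l) (nmap D l p)))"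
proof -
  let ?f = "\<lambda>l. face_int D l (g l)"
  let ?I = "lfaces D - bfaces D"
  have "(\<Sum>e\<in>elems D. elem_bd_int D e g) = sum ?f (lfaces D)"
    unfolding elem_bd_int_def lfaces_def by (subst sum.cartesian_product) (simp add: case_prod_unfold)
  also have "\<dots> = sum ?f ?I + sum ?f (bfaces D)"
    by (rule sum.subset_diff[OF bfaces_lfaces finite_lfaces])
  also have "sum ?f ?I = sum ?f (left_faces D) + sum ?f {l \<in> ?I. \<not> is_left D l}"
    unfolding left_faces_def
    by (subst sum.union_disjoint[symmetric]) (auto intro!: sum.cong)
  also have "sum ?f {l \<in> ?I. \<not> is_left D l} = (\<Sum>l\<in>left_faces D. ?f (nbr D l))"
    by (rule sum.reindex_bij_witness[of _ "nbr D" "nbr D"])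
       (use interior_face in \<open>auto simp: left_faces_def\<close>)
  also have "\<dots> = (\<Sum>l\<in>left_faces D. face_int D l (\<lambda>p. g (nbr D l) (nmap D l p)))"
    by (intro sum.cong refl face_int_nbr) (auto simp: left_faces_def)
  finally show ?thesis by (simp add: face_int_add sum.distrib)
qed

lemma left_face:
  assumes "l \<in> left_faces D"
  shows "l \<in> lfaces D" "l \<notin> bfaces D" "is_left D l" "nbr D l \<in> lfaces D" "nbr D l \<notin> bfaces D"
    and "\<not> is_left D (nbr D l)" "nbr D (nbr D l) = l"
  using assms interior_face[of l] by (auto simp: left_faces_def)

lemma left_face_sides:
  assumes l: "l \<in> left_faces D" and p: "p \<in> face_nodes D l"
  shows "lside D l p = (l, p)" "rside D l p = (nbr D l, nmap D l p)"
    and "lside D (nbr D l) (nmap D l p) = (l, p)"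
    and "rside D (nbr D l) (nmap D l p) = (nbr D l, nmap D l p)"
    and "nvec D (nbr D l) (nmap D l p) = - nvec D l p"
    and "nmap D l p \<in> face_nodes D (nbr D l)"
  using left_face[OF l] interior_face_node[of l p] p by (auto simp: lside_def rside_def)

text \<open>Both elements resolve an interface to the same left and right data. Their contributions
  can therefore differ only through their own traces and the direction of the normal.\<close>

lemma left_face_traces:
  assumes l: "l \<in> left_faces D" and p: "p \<in> face_nodes D l"
  shows "atL D g l p = g (fst l) p" "atR D g l p = g (fst (nbr D l)) (nmap D l p)"
    and "atL D g (nbr D l) (nmap D l p) = g (fst l) p"
    and "atR D g (nbr D l) (nmap D l p) = g (fst (nbr D l)) (nmap D l p)"
    and "avg D h (nbr D l) (nmap D l p) = avg D h l p"
    and "jump D h (nbr D l) (nmap D l p) = jump D h l p"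
    and "nL D l p = nvec D l p" "nL D (nbr D l) (nmap D l p) = nvec D l p"
    and "frameL D l p = frame D l p" "frameL D (nbr D l) (nmap D l p) = frame D l p"
    and "beta D par (nbr D l) (nmap D l p) = beta D par l p"
  by (simp_all add: atL_def atR_def avg_def jump_def nL_def frameL_def beta_def sjacL_def
      left_face_sides[OF assms])

lemma frame_orthogonal:
  assumes "l \<in> left_faces D \<union> bfaces D" "p \<in> face_nodes D l"
  shows "orthogonal_matrix (frame D l p)" "frame D l p $ 1 = nvec D l p"
  using assms mesh unfolding dg_mesh_def by blast+

lemma norm_nvec:
  assumes "l \<in> lfaces D" "p \<in> face_nodes D l"
  shows "nvec D l p \<bullet> nvec D l p = 1"
  using sjac_pos[OF assms]
  by (auto simp: nvec_def sjac_def dot_square_norm power2_eq_square split: prod.splits)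

lemma beta_nonneg:
  assumes "l \<in> left_faces D" "p \<in> face_nodes D l" "0 \<le> kappa par"
  shows "0 \<le> beta D par l p"
proof -
  have "0 < jac D (fst l) p" "0 < jac D (fst (nbr D l)) (nmap D l p)" "0 < sjac D l p"
    using left_face[OF assms(1)] left_face_sides(6)[OF assms(1,2)] assms(2)
    by (auto intro!: jac_pos sjac_pos lface_elem face_nodes_nodes)
  thus ?thesis
    using assms(3)
    by (simp add: beta_def avg_def sjacL_def atL_def atR_def left_face_sides[OF assms(1,2)])
qed

end

section \<open>Entropy production of the inviscid interface fluxes\<close>

lemma exhaust_5: "x = 1 \<or> x = 2 \<or> x = 3 \<or> x = 4 \<or> x = 5" for x :: 5
proof (induct x)
  case (of_int z)
  then have "0 \<le> z" and "z < 5" by simp_all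
  then have "z = 0 \<or> z = 1 \<or> z = 2 \<or> z = 3 \<or> z = 4" by arith
  then show ?case by auto
qed

lemma UNIV_5: "UNIV = {1::5, 2, 3, 4, 5}"
  using exhaust_5 by auto

lemma sum_5: "sum f (UNIV :: 5 set) = f 1 + f 2 + f 3 + f 4 + f 5"
  unfolding UNIV_5 by (simp add: add.assoc)

lemma forall_5: "(\<forall>i::5. P i) \<longleftrightarrow> P 1 \<and> P 2 \<and> P 3 \<and> P 4 \<and> P 5"
  by (metis exhaust_5)

lemma blk_nth [simp]:
  "blk a u b $ 1 = a" "blk a u b $ 2 = u $ 1" "blk a u b $ 3 = u $ 2" "blk a u b $ 4 = u $ 3"
  "blk a u b $ 5 = b"
  by (simp_all add: blk_def)

lemma vrows_blk [simp]: "vrows (blk a u b) = u"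
  by (simp add: vec_eq_iff vrows_def forall_3)

lemma vrows_nth [simp]: "vrows v $ 1 = v $ 2" "vrows v $ 2 = v $ 3" "vrows v $ 3 = v $ 4"
  by (simp_all add: vrows_def)

lemma inner_5:
  fixes v w :: "('a::real_inner)^5"
  shows "v \<bullet> w = v $ 1 \<bullet> w $ 1 + vrows v \<bullet> vrows w + v $ 5 \<bullet> w $ 5"
  by (simp add: inner_vec_def sum_5 sum_3)

lemma rotT_mult: "rotT R *v v = blk (v $ 1) (R *v vrows v) (v $ 5)"
  by (simp add: vec_eq_iff forall_5 rotT_def matrix_vector_mult_def sum_5 sum_3 axis_def)

text \<open>Moving the rotation to the test vector lets the Riemann solver fluxes be evaluated in
  the face frame.\<close>

lemma inner_rotT:
  "v \<bullet> (transpose (rotT R) *v blk a u b) = v $ 1 * a + (R *v vrows v) \<bullet> u + v $ 5 * b"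
proof -
  have "v \<bullet> (transpose (rotT R) *v blk a u b) = (rotT R *v v) \<bullet> blk a u b"
    by (metis dot_lmul_matrix inner_commute transpose_matrix_vector)
  thus ?thesis by (simp add: rotT_mult inner_5)
qed

section \<open>Nodal identities between fluxes and entropy variables\<close>

locale physics =
  fixes par :: params
  assumes valid: "valid_params par"
begin

lemma pos: "0 < sigma par" "0 < eps par" "0 < M0 par" "0 < rho1 par" "0 < rho2 par"
    "0 < c0 par" "0 \<le> kappa par" "0 < rho0 par"
  using valid by (auto simp: valid_params_def rho0_def)

abbreviation K :: real where "K \<equiv> rho0 par * (c0 par)^2"

lemma K_pos: "0 < K" using pos by simp

lemma dens_pos [simp]: "0 < dens par q"
proof -
  have "0 < rho1 par * c + rho2 par * (1 - c)" if "0 \<le> c" "c \<le> 1" for c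
    using that pos by (cases "c = 0") (auto intro!: add_pos_nonneg)
  thus ?thesis unfolding dens_def rho_def Let_def by simp
qed

lemma Wvar_nth [simp]: "Wvar par q m $ 1 = m" "vrows (Wvar par q m) = vel par q"
  "Wvar par q m $ 5 = pres q / K"
  by (simp_all add: Wvar_def)

lemma bdot_Fe:
  "bdot (Fe par q) n = blk (conc q * (vel par q \<bullet> n))
     ((1/2 * dens par q * (vel par q \<bullet> n)) *\<^sub>R vel par q + pres q *\<^sub>R n) 0"
  by (simp add: vec_eq_iff forall_5 bdot_def Fe_def inner_add_left inner_axis' mult_ac)

text \<open>\<open>Fe\<close> and \<open>Phi\<close> share the same half of the convective term, and
  the factor \<open>K\<close> in the last row of \<open>Phi\<close> cancels the denominator of the
  fifth entropy variable, which restores the pressure.\<close>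

lemma inner_W_Phi:
  "Wvar par q m \<bullet> bdot (Phi par q $ k) n = bdot (Fe par q) n $ k"
proof -
  have "\<forall>k. Wvar par q m \<bullet> bdot (Phi par q $ k) n = bdot (Fe par q) n $ k"
    using pos(6,8) unfolding bdot_Fe
    by (simp add: forall_5 inner_vec_def sum_5 sum_3 bdot_def Phi_def axis_def Wvar_def algebra_simps)
  thus ?thesis by blast
qed

lemma inner_W_Fe:
  "Wvar par q m \<bullet> bdot (Fe par q') n
    = m * conc q' * (vel par q' \<bullet> n)
    + 1/2 * dens par q' * (vel par q' \<bullet> n) * (vel par q \<bullet> vel par q') + pres q' * (vel par q \<bullet> n)"
  by (simp add: inner_5 bdot_Fe inner_add_right)

text \<open>The scheme subtracts both \<open>Fe\<close> and the local sum of \<open>Phi\<close>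
  times \<open>W\<close>. Contracted with \<open>W\<close> these are equal, and summation by parts
  returns one of them; hence \<open>Fe\<close> is subtracted once.\<close>

definition production :: "iflux \<Rightarrow> real^3^3 \<Rightarrow> trace \<Rightarrow> trace \<Rightarrow> trace \<Rightarrow> real" where
  "production flx R zL zR z = Wvar par (fst z) (snd z) \<bullet>
     (Fe_star flx par R zL zR + Phi_diamond flx par R zL zR z - bdot (Fe par (fst z)) (R $ 1))"

text \<open>By \<open>inner_W_Phi\<close> the diamond flux is the mirror image of the averaged flux:
  the trace being tested and the trace supplying the flux exchange roles.\<close>

lemma production_central:
  "production Central R zL zR z
    = 1/2 * (Wvar par (fst z) (snd z) \<bullet> bdot (Fe par (fst zL)) (R $ 1)
           + Wvar par (fst z) (snd z) \<bullet> bdot (Fe par (fst zR)) (R $ 1))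
    + 1/2 * (Wvar par (fst zL) (snd zL) \<bullet> bdot (Fe par (fst z)) (R $ 1)
           + Wvar par (fst zR) (snd zR) \<bullet> bdot (Fe par (fst z)) (R $ 1))
    - Wvar par (fst z) (snd z) \<bullet> bdot (Fe par (fst z)) (R $ 1)"
proof -
  have "bdot ((1/2) *\<^sub>R (Fe par (fst zL) + Fe par (fst zR))) (R $ 1)
      = (1/2) *\<^sub>R (bdot (Fe par (fst zL)) (R $ 1) + bdot (Fe par (fst zR)) (R $ 1))"
    by (simp add: vec_eq_iff bdot_def inner_add_left distrib_left)
  moreover have "Wvar par (fst z) (snd z) \<bullet> Phi_diamond Central par R zL zR z
      = (1/2) * ((Wvar par (fst zL) (snd zL) + Wvar par (fst zR) (snd zR))
                   \<bullet> bdot (Fe par (fst z)) (R $ 1))"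
    by (simp add: Phi_diamond_def inner_sum_right inner_W_Phi
        inner_vec_def[of "_ + _ :: real^5"] sum_distrib_left mult_ac)
  ultimately show ?thesis
    by (simp add: production_def Fe_star_def inner_add_right inner_add_left inner_diff_right)
qed

text \<open>For either trace the production reduces to half of W_L . F_R + W_R . F_L, which is
  symmetric in the two sides.\<close>

lemma production_central_interior:
  "production Central R zL zR zL - production Central R zL zR zR = 0"
  unfolding production_central by (simp add: field_simps)

section \<open>The exact Riemann solver in the face frame\<close>

lemma Vn_eq: "Vn par R z = vel par (fst z) \<bullet> (R $ 1)"
  by (simp add: Vn_def matrix_vector_mul_component inner_commute)

lemma inner_rotated:
  assumes "orthogonal_matrix R"
  shows "(R *v u) \<bullet> (R *v v) = (u::real^3) \<bullet> v"
  using assms by (metis orthogonal_matrix_def dot_lmul_matrix matrix_vector_mul_assoc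
      matrix_vector_mul_lid transpose_matrix_vector inner_commute)

lemma inner_vel:
  assumes "orthogonal_matrix R"
  shows "vel par (fst z) \<bullet> vel par (fst z') = Vn par R z * Vn par R z'
     + Vt1 par R z * Vt1 par R z' + Vt2 par R z * Vt2 par R z'"
  by (subst inner_rotated[OF assms, symmetric])
     (simp add: inner_vec_def sum_3 Vn_def Vt1_def Vt2_def)

text \<open>The purely local convective terms of the diamond flux cancel the kinetic part of
  \<open>Fe\<close>, so every remaining kinetic term carries the common mass flux
  \<open>r * u\<close>.\<close>

lemma production_ers:
  fixes R :: "real^3^3" and zL zR z :: trace
  assumes "orthogonal_matrix R"
  defines "u \<equiv> Vn_star par R zL zR" and "r \<equiv> rho_star par R zL zR"
  shows "production ERS R zL zR z
    = snd z * (1/2 * (conc (fst zL) * Vn par R zL + conc (fst zR) * Vn par R zR))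
    + conc (fst z) * Vn par R z * (1/2 * (snd zL + snd zR)) - snd z * conc (fst z) * Vn par R z
    + r * u * (u * Vn par R z - (Vn par R z)^2 / 2
        + Vt1_star par R zL zR * Vt1 par R z - (Vt1 par R z)^2 / 2
        + Vt2_star par R zL zR * Vt2 par R z - (Vt2 par R z)^2 / 2)
    + Vn par R z * P_star par R zL zR + pres (fst z) * u - pres (fst z) * Vn par R z"
proof -
  have V: "(R *v vel par (fst z)) \<bullet> vector [a, b, c]
      = Vn par R z * a + Vt1 par R z * b + Vt2 par R z * c" for a b c
    by (simp add: inner_vec_def sum_3 Vn_def Vt1_def Vt2_def)
  have K: "pres (fst z) / K * (K * a) = pres (fst z) * a" for a
    using pos(6,8) by simp
  show ?thesis
    unfolding production_def Fe_star_def Phi_diamond_def u_def r_def Let_def iflux.case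
      inner_add_right inner_diff_right inner_rotT inner_W_Fe Wvar_nth V K
      inner_vel[OF assms(1)] Vn_eq[symmetric]
    by (simp add: algebra_simps power2_eq_square)
qed

text \<open>The acoustic term under the root is positive, so \<open>ers_a\<close> strictly exceeds
  the absolute normal velocity. This makes the acoustic mass fluxes positive and the denominators of
  the star state nonzero.\<close>

lemma lam_signs: "0 < lam_plus par R z" "lam_minus par R z < 0"
proof -
  have "(Vn par R z)^2 < (Vn par R z)^2 + 4 * rho0 par * (c0 par)^2 / dens par (fst z)"
    using K_pos by (simp add: mult.assoc)
  hence "sqrt ((Vn par R z)^2) < ers_a par R z"
    unfolding ers_a_def by (rule real_sqrt_less_mono)
  hence "\<bar>Vn par R z\<bar> < ers_a par R z" by simp
  thus "0 < lam_plus par R z" "lam_minus par R z < 0"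
    by (auto simp: lam_plus_def lam_minus_def)
qed

lemma production_ers_interior:
  assumes R: "orthogonal_matrix R"
  shows "0 \<le> production ERS R zL zR zL - production ERS R zL zR zR"
proof -
  define mL where "mL = dens par (fst zL) * lam_plus par R zL"
  define mR where "mR = - (dens par (fst zR) * lam_minus par R zR)"
  define u where "u = Vn_star par R zL zR"
  define r where "r = rho_star par R zL zR"
  define Ps where "Ps = P_star par R zL zR"
  define a where "a = Vn par R zL - u"
  define b where "b = Vn par R zR - u"
  define w1 where "w1 = Vt1_star par R zL zR"
  define w2 where "w2 = Vt2_star par R zL zR"
  have mL: "0 < mL" and mR: "0 < mR"
    using lam_signs[of R zL] lam_signs[of R zR] by (auto simp: mL_def mR_def mult_pos_neg)
  \<comment> \<open>The star velocity is the one for which the left and the right wave predict the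
    same star pressure; \<open>PL\<close> and \<open>PR\<close> are the two resulting jump
    relations.\<close>
  have "(mL + mR) * u = pres (fst zL) - pres (fst zR) + mL * Vn par R zL + mR * Vn par R zR"
    using mL mR unfolding u_def Vn_star_def mL_def mR_def by (simp add: field_simps)
  hence PR: "pres (fst zR) = Ps + mR * b" and PL: "pres (fst zL) = Ps - mL * a"
    by (simp_all add: Ps_def P_star_def mL_def[symmetric] u_def[symmetric] a_def b_def algebra_simps)
  \<comment> \<open>Since the acoustic speeds straddle zero, the star mass flux is a fraction
    \<open>s\<close> in [0,1] of the acoustic mass flux on the upwind side.\<close>
  have mass: "- mR \<le> 1/2 * (r * u) \<and> 1/2 * (r * u) \<le> mL \<and> (0 \<le> u \<longrightarrow> 0 \<le> r * u)
      \<and> (u < 0 \<longrightarrow> r * u \<le> 0)"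
  proof (cases "0 \<le> u")
    case True
    define s where "s = u / (u - lam_minus par R zL)"
    have s: "0 \<le> s" "s \<le> 1" using True lam_signs(2)[of R zL] by (auto simp: s_def divide_le_eq)
    have ru: "r * u = mL * s"
      using True by (simp add: r_def rho_star_def u_def[symmetric] mL_def s_def)
    have "0 \<le> mL * s" "mL * s \<le> mL" using s mL by (simp_all add: mult_left_le)
    thus ?thesis unfolding ru using True mL mR by linarith
  next
    case False
    define s where "s = u / (u - lam_plus par R zR)"
    have s: "0 \<le> s" "s \<le> 1"
      using False lam_signs(1)[of R zR] by (auto simp: s_def divide_le_eq zero_le_divide_iff)
    have ru: "r * u = - (mR * s)"
      using False by (simp add: r_def rho_star_def u_def[symmetric] mR_def s_def)
    have "0 \<le> mR * s" "mR * s \<le> mR" using s mR by (simp_all add: mult_left_le)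
    thus ?thesis unfolding ru using False mL mR by linarith
  qed
  \<comment> \<open>The upwind value minus the mean is half the difference of the traces, with a
    sign that follows \<open>u\<close>; so does the sign of \<open>r * u\<close>.\<close>
  have upwind: "0 \<le> r * u * ((xL - xR) * ((if 0 \<le> u then xL else xR) - (xL + xR) / 2))" for xL xR
  proof (cases "0 \<le> u")
    case True
    have half: "(xL - xR) * (xL - (xL + xR) / 2) = 1/2 * (xL - xR)^2"
      by (simp add: power2_eq_square field_simps)
    show ?thesis unfolding if_P[OF True] half using mass True by simp
  next
    case False
    have half: "(xL - xR) * (xR - (xL + xR) / 2) = - (1/2 * (xL - xR)^2)"
      by (simp add: power2_eq_square field_simps)
    show ?thesis unfolding if_not_P[OF False] half using mass False by (intro mult_nonpos_nonpos) auto
  qed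
  \<comment> \<open>The chemical terms are symmetric and cancel. The pressure terms leave mL a^2 +
    mR b^2, and writing u x - x^2/2 as u^2/2 - (x - u)^2/2 adds r u (b^2 - a^2)/2.\<close>
  have "production ERS R zL zR zL - production ERS R zL zR zR
      = (mR + 1/2 * (r * u)) * b^2 + (mL - 1/2 * (r * u)) * a^2
      + r * u * ((Vt1 par R zL - Vt1 par R zR) * (w1 - (Vt1 par R zL + Vt1 par R zR) / 2))
      + r * u * ((Vt2 par R zL - Vt2 par R zR) * (w2 - (Vt2 par R zL + Vt2 par R zR) / 2))"
  proof -
    have un: "Vn par R zL = a + u" "Vn par R zR = b + u" by (simp_all add: a_def b_def)
    show ?thesis
      unfolding production_ers[OF R] u_def[symmetric] r_def[symmetric] Ps_def[symmetric]
        w1_def[symmetric] w2_def[symmetric] un PL PR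
      by (simp add: field_simps power2_eq_square)
  qed
  moreover have "0 \<le> (mR + 1/2 * (r * u)) * b^2" "0 \<le> (mL - 1/2 * (r * u)) * a^2"
    using mass by (auto intro!: mult_nonneg_nonneg)
  moreover have "0 \<le> r * u * ((Vt1 par R zL - Vt1 par R zR) * (w1 - (Vt1 par R zL + Vt1 par R zR) / 2))"
    "0 \<le> r * u * ((Vt2 par R zL - Vt2 par R zR) * (w2 - (Vt2 par R zL + Vt2 par R zR) / 2))"
    using upwind by (simp_all add: w1_def w2_def Vt1_star_def Vt2_star_def u_def[symmetric])
  ultimately show ?thesis by linarith
qed

lemma production_interior:
  assumes "orthogonal_matrix R"
  shows "0 \<le> production flx R zL zR zL - production flx R zL zR zR"
  using production_ers_interior[OF assms, of zL zR] production_central_interior[of R zL zR]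
  by (cases flx) simp_all

section \<open>Walls as interfaces with a mirrored state\<close>

lemma ghost_simps [simp]:
  "conc (fst (ghost n z)) = conc (fst z)" "pres (fst (ghost n z)) = pres (fst z)"
  "snd (ghost n z) = snd z" "dens par (fst (ghost n z)) = dens par (fst z)"
  by (simp_all add: ghost_def Let_def conc_def pres_def dens_def)

lemma vel_ghost:
  "vel par (fst (ghost n z)) = vel par (fst z) - (2 * (vel par (fst z) \<bullet> n)) *\<^sub>R n"
  unfolding vel_def ghost_simps
  by (simp add: ghost_def Let_def scaleR_diff_right)

lemma rotated_normal:
  assumes "orthogonal_matrix R"
  shows "R *v (R $ 1) = axis 1 (1::real)"
proof -
  have "R ** transpose R = mat 1" using assms by (simp add: orthogonal_matrix_def)
  hence "(R ** transpose R) $ k $ 1 = mat 1 $ k $ 1" for k by simp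
  thus ?thesis
    by (simp add: vec_eq_iff matrix_matrix_mult_def matrix_vector_mult_def transpose_def mat_def axis_def)
qed

lemma V_ghost:
  assumes "orthogonal_matrix R"
  shows "Vn par R (ghost (R $ 1) z) = - Vn par R z" "Vt1 par R (ghost (R $ 1) z) = Vt1 par R z"
    "Vt2 par R (ghost (R $ 1) z) = Vt2 par R z"
proof -
  have "R *v vel par (fst (ghost (R $ 1) z))
      = R *v vel par (fst z) - (2 * Vn par R z) *\<^sub>R axis 1 1"
    unfolding vel_ghost Vn_eq
    by (simp add: matrix_vector_mult_diff_distrib matrix_vector_mult_scaleR rotated_normal[OF assms])
  thus "Vn par R (ghost (R $ 1) z) = - Vn par R z" "Vt1 par R (ghost (R $ 1) z) = Vt1 par R z"
    "Vt2 par R (ghost (R $ 1) z) = Vt2 par R z"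
    by (simp_all add: Vn_def Vt1_def Vt2_def axis_def)
qed

text \<open>Reflection exchanges the two acoustic mass fluxes, so the star velocity vanishes and no
  mass crosses the wall. What remains for the Riemann solver is the work of the excess pressure
  \<open>P_star - P\<close> on the normal velocity.\<close>

lemma production_wall:
  assumes R: "orthogonal_matrix R"
  shows "0 \<le> production flx R z (ghost (R $ 1) z) z"
    and "production Central R z (ghost (R $ 1) z) z = 0"
proof -
  let ?g = "ghost (R $ 1) z"
  show central: "production Central R z ?g z = 0"
    unfolding production_central inner_W_Fe ghost_simps inner_vel[OF R] Vn_eq[symmetric] V_ghost[OF R]
    by (simp add: algebra_simps)
  have lam: "lam_minus par R ?g = - lam_plus par R z"
    by (simp add: lam_plus_def lam_minus_def ers_a_def V_ghost[OF R] field_simps)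
  have u: "Vn_star par R z ?g = 0"
    by (simp add: Vn_star_def lam V_ghost[OF R])
  have "production ERS R z ?g z = dens par (fst z) * lam_plus par R z * (Vn par R z)^2"
    unfolding production_ers[OF R] P_star_def u
    by (simp add: V_ghost[OF R] algebra_simps power2_eq_square)
  also have "\<dots> \<ge> 0" 
    using lam_signs(1)[of R z] less_imp_le[OF dens_pos] by (intro mult_nonneg_nonneg) auto
  finally show "0 \<le> production flx R z ?g z" using central by (cases flx) auto
qed

end

section \<open>Entropy balance at a fixed time\<close>

lemma DERIV_inner_self:
  fixes f :: "real \<Rightarrow> real^'n"
  assumes "\<And>k. ((\<lambda>s. f s $ k) has_real_derivative f' $ k) (at t within S)"
  shows "((\<lambda>s. f s \<bullet> f s) has_real_derivative 2 * (f t \<bullet> f')) (at t within S)"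
proof -
  have "((\<lambda>s. f s \<bullet> f s) has_real_derivative (\<Sum>k\<in>UNIV. f' $ k * f t $ k + f' $ k * f t $ k)) (at t within S)"
    unfolding inner_vec_def inner_real_def by (intro DERIV_sum DERIV_mult assms)
  also have "(\<Sum>k\<in>UNIV. f' $ k * f t $ k + f' $ k * f t $ k) = 2 * (f t \<bullet> f')"
    by (simp add: inner_vec_def sum_distrib_left mult_ac)
  finally show ?thesis .
qed

locale scheme = mesh \<Omega> D + physics par
  for \<Omega> :: "(real^3) set" and D :: "'e dg" and par :: params
begin

abbreviation V :: "(mindex \<Rightarrow> 'b::real_inner) \<Rightarrow> (mindex \<Rightarrow> 'b) \<Rightarrow> real" where
  "V \<equiv> vinner (deg D) (wgt D)"

abbreviation pen :: real where
  "pen \<equiv> 3/2 * sigma par * eps par"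

text \<open>Contraction with \<open>W\<close> acts on the rows and the metric on the space index.
  The two commute, so \<open>inner_W_Phi\<close> passes to contravariant components whatever the
  metric is.\<close>

lemma inner_W_bdot_bcontra_Phi:
  "Wvar par q m \<bullet> bdot (bcontra D e (\<lambda>q. Phi par (f q) $ k) p) g
    = (metric D e p *v (Fe par (f p) $ k)) \<bullet> g" if "q = f p"
proof -
  let ?g = "transpose (metric D e p) *v g"
  have t: "(metric D e p *v v) \<bullet> g = v \<bullet> ?g" for v
    by (metis dot_lmul_matrix inner_commute transpose_matrix_vector)
  have "bdot (bcontra D e (\<lambda>q. Phi par (f q) $ k) p) g = bdot (Phi par q $ k) ?g"
    by (simp add: vec_eq_iff bdot_def bcontra_def t that)
  thus ?thesis by (simp add: inner_W_Phi t that) (simp add: bdot_def)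
qed

text \<open>Skew symmetry of the split form: contracting \<open>\<Phi>\<^sub>m\<close> with \<open>W\<close> returns row \<open>m\<close> of the inviscid
  flux, so only face terms survive summation by parts.\<close>

lemma inviscid_volume:
  assumes e: "e \<in> elems D"
  shows "V (Wat par F e) (bdiv (deg D) (node D) (bcontra D e (\<lambda>q. Fe par (fQ F e q))))
     + (\<Sum>m\<in>UNIV. V (Wat par F e)
         (\<lambda>p. bdot (bcontra D e (\<lambda>q. Phi par (fQ F e q) $ m) p)
                   (grad (deg D) (node D) (\<lambda>q. Wat par F e q $ m) p)))
     = elem_bd_int D e (\<lambda>l p. Wat par F e p \<bullet> bdot (Fe par (fQ F e p)) (nvec D l p))"
proof -
  have "V (bcontra D e (\<lambda>q. Fe par (fQ F e q))) (bgrad (deg D) (node D) (Wat par F e))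
      = (\<Sum>m\<in>UNIV. V (Wat par F e)
         (\<lambda>p. bdot (bcontra D e (\<lambda>q. Phi par (fQ F e q) $ m) p)
                   (grad (deg D) (node D) (\<lambda>q. Wat par F e q $ m) p)))"
    by (subst vinner_component)
       (simp add: vinner_def inner_W_bdot_bcontra_Phi bcontra_def[of D e "\<lambda>q. Fe par (fQ F e q)"]
         bgrad_def)
  thus ?thesis using vinner_bdiv_bcontra[OF e, of "Wat par F e" "\<lambda>q. Fe par (fQ F e q)"] by simp
qed

definition inviscid_face :: "iflux \<Rightarrow> 'e fields \<Rightarrow> 'e lface \<Rightarrow> mindex \<Rightarrow> real" where
  "inviscid_face flx F l p = Wat par F (fst l) p \<bullet>
     (Fe_star_n D par flx F l p + Phi_diamond_n D par flx F l p
      - bdot (Fe par (fQ F (fst l) p)) (nvec D l p))"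

lemma bdot_minus: "bdot H (- n) = - bdot H n"
  by (simp add: vec_eq_iff bdot_def)

text \<open>On the right side \<open>own_sign\<close> reverses the star fluxes and the opposite
  normal reverses the local flux, whence the minus sign.\<close>

lemma inviscid_face_interior:
  fixes F :: "'e fields"
  assumes l: "l \<in> left_faces D" and p: "p \<in> face_nodes D l"
  defines "zL \<equiv> zown F (fst l) p" and "zR \<equiv> zown F (fst (nbr D l)) (nmap D l p)"
  shows "inviscid_face flx F l p + inviscid_face flx F (nbr D l) (nmap D l p)
    = production flx (frame D l p) zL zR zL - production flx (frame D l p) zL zR zR"
proof -
  note tr = left_face_traces[OF l p]
  have z: "zleft D F l p = zL" "zright D F l p = zR"
    "zleft D F (nbr D l) (nmap D l p) = zL" "zright D F (nbr D l) (nmap D l p) = zR"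
    by (simp_all add: zleft_def zright_def tr left_face[OF l] zL_def zR_def)
  have n: "frame D l p $ 1 = nvec D l p"
    using frame_orthogonal(2)[of l p] l p by blast
  show ?thesis
    unfolding inviscid_face_def production_def Fe_star_n_def Phi_diamond_n_def z tr n
      left_face_sides(5)[OF l p] bdot_minus
    by (simp add: own_sign_def left_face[OF l] zL_def zR_def zown_def
        inner_add_right inner_diff_right)
qed

lemma inviscid_face_wall:
  fixes F :: "'e fields"
  assumes l: "l \<in> bfaces D" and p: "p \<in> face_nodes D l"
  defines "z \<equiv> zown F (fst l) p"
  shows "inviscid_face flx F l p = production flx (frame D l p) z (ghost (frame D l p $ 1) z) z"
proof -
  have n: "frame D l p $ 1 = nvec D l p"
    using frame_orthogonal(2)[of l p] l p by blast
  show ?thesis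
    unfolding inviscid_face_def production_def Fe_star_n_def Phi_diamond_n_def n
    using l by (simp add: own_sign_def zleft_def zright_def atL_def lside_def frameL_def
        zown_def z_def)
qed

lemma sum_inviscid_face:
  "0 \<le> (\<Sum>e\<in>elems D. elem_bd_int D e (inviscid_face flx F))"
  "(\<Sum>e\<in>elems D. elem_bd_int D e (inviscid_face Central F)) = 0"
proof -
  show "0 \<le> (\<Sum>e\<in>elems D. elem_bd_int D e (inviscid_face flx F))"
    unfolding sum_elem_bd_int
  proof (rule add_nonneg_nonneg; intro sum_nonneg face_int_nonneg)
    fix l p assume l: "l \<in> bfaces D" and p: "p \<in> face_nodes D l"
    show "0 \<le> inviscid_face flx F l p"
      using production_wall(1) frame_orthogonal(1)[of l p] l p by (simp add: inviscid_face_wall)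
  next
    fix l p assume l: "l \<in> left_faces D" and p: "p \<in> face_nodes D l"
    show "0 \<le> inviscid_face flx F l p + inviscid_face flx F (nbr D l) (nmap D l p)"
      unfolding inviscid_face_interior[OF l p]
      using production_interior frame_orthogonal(1)[of l p] l p by blast
  qed (use bfaces_lfaces left_face(1) in auto)
  have "face_int D l (inviscid_face Central F l) = 0" if l: "l \<in> bfaces D" for l
    using production_wall(2) frame_orthogonal(1)[of l] l
    by (simp add: face_int_def inviscid_face_wall)
  moreover have "face_int D l
      (\<lambda>p. inviscid_face Central F l p + inviscid_face Central F (nbr D l) (nmap D l p)) = 0"
    if l: "l \<in> left_faces D" for l
    unfolding face_int_def
    by (intro sum.neutral ballI)
       (simp only: inviscid_face_interior[OF l] production_central_interior mult_zero_right)
  ultimately show "(\<Sum>e\<in>elems D. elem_bd_int D e (inviscid_face Central F)) = 0"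
    unfolding sum_elem_bd_int by simp
qed

lemma inviscid_terms:
  assumes e: "e \<in> elems D"
  shows "elem_bd_int D e (\<lambda>l p. Wat par F e p \<bullet>
         (Fe_star_n D par flx F l p - bdot (Fe par (fQ F e p)) (nvec D l p)
          + (Phi_diamond_n D par flx F l p
             - (\<Sum>m\<in>UNIV. Wat par F e p $ m *\<^sub>R bdot (Phi par (fQ F e p) $ m) (nvec D l p)))))
     + elem_bd_int D e (\<lambda>l p. Wat par F e p \<bullet> bdot (Fe par (fQ F e p)) (nvec D l p))
     = elem_bd_int D e (inviscid_face flx F)"
proof -
  have "W \<bullet> (\<Sum>m\<in>UNIV. W $ m *\<^sub>R bdot (Phi par q $ m) n) = W \<bullet> bdot (Fe par q) n"
    if "W = Wvar par q m" for W q m n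
    by (simp add: inner_sum_right inner_W_Phi that inner_vec_def[of _ "bdot (Fe par q) n"])
  thus ?thesis unfolding elem_bd_int_add[symmetric]
    by (intro elem_bd_int_cong)
       (simp add: inviscid_face_def inner_add_right inner_diff_right)
qed

section \<open>Viscous terms: dissipation, walls and interfaces\<close>

lemma transpose_strain: "transpose (strain g) = strain g"
  by (simp add: vec_eq_iff transpose_def strain_def add.commute)

lemma strain_axis: "strain g *v axis i 1 = strain g $ i"
proof -
  have "strain g *v axis i 1 = transpose (strain g) $ i"
    by (simp add: matrix_vector_mult_basis column_def transpose_def)
  thus ?thesis by (simp add: transpose_strain)
qed

lemma bdot_Fv:
  "bdot (Fv par q g) n = blk (M0 par * (g $ 1 \<bullet> n)) ((2 * eta par (conc q)) *\<^sub>R (strain g *v n)) 0"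
  by (simp add: vec_eq_iff forall_5 bdot_def Fv_def strain_axis matrix_vector_mul_component)

text \<open>Against a symmetric stress the velocity gradient may be replaced by its symmetric
  part.\<close>

lemma inner_Fv:
  "g \<bullet> Fv par q g
    = M0 par * (norm (g $ 1))^2 + 2 * eta par (conc q) * (strain g \<bullet> strain g)"
proof -
  have "vrows (Fv par q g) = (2 * eta par (conc q)) *\<^sub>R strain g"
    by (simp add: Fv_def vec_eq_iff strain_axis)
  moreover have "vrows g \<bullet> strain g = strain g \<bullet> strain g"
    by (simp add: strain_def transpose_def inner_vec_def sum_3 algebra_simps)
  ultimately show ?thesis
    unfolding inner_5[of g] by (simp add: Fv_def power2_norm_eq_inner)
qed

text \<open>The first summand stems from the state equation tested with \<open>W\<close>, the second
  from the gradient equation tested with \<open>Fv\<close>; the volume terms of the two equations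
  cancel.\<close>

definition viscous_face :: "'e fields \<Rightarrow> 'e lface \<Rightarrow> mindex \<Rightarrow> real" where
  "viscous_face F l p = Wat par F (fst l) p \<bullet> Fv_star_n D par F l p
     + (W_star D par F l p - Wat par F (fst l) p) \<bullet> bdot (Fvat par F (fst l) p) (nvec D l p)"

text \<open>With free slip both summands vanish. With no slip the work of the wall stress on the
  interior velocity is offset by the velocity jump to the wall; the chemical row carries neither
  flux nor jump.\<close>

lemma viscous_face_wall:
  assumes l: "l \<in> bfaces D"
  shows "viscous_face F l p = 0"
  using l by (cases "wall_bc D l")
    (simp_all add: viscous_face_def Fv_star_n_def W_star_def bdot_Fv inner_5 Wvar_def
      vrows_def[of "_ - _"] inner_diff_left inner_vec_def sum_3 algebra_simps)

text \<open>The averaged flux contributes -[W].{F} and the averaged \<open>W\<close> contributes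
  +[W].{F}; only the penalty survives, and it acts on the chemical row alone.\<close>

lemma viscous_face_interior:
  assumes l: "l \<in> left_faces D" and p: "p \<in> face_nodes D l"
  shows "viscous_face F l p + viscous_face F (nbr D l) (nmap D l p)
    = - (beta D par l p * (jump D (fmu F) l p)^2)"
proof -
  note tr = left_face_traces[OF l p]
  let ?n = "nvec D l p"
  define WL where "WL = Wat par F (fst l) p"
  define WR where "WR = Wat par F (fst (nbr D l)) (nmap D l p)"
  define FL where "FL = bdot (Fvat par F (fst l) p) ?n"
  define FR where "FR = bdot (Fvat par F (fst (nbr D l)) (nmap D l p)) ?n"
  define b where "b = beta D par l p * jump D (fmu F) l p"
  have n1: "?n \<bullet> ?n = 1" using norm_nvec[of l p] left_face[OF l] p by simp
  have "bdot (avg D (Fvat par F) l p + blk (b *\<^sub>R ?n) 0 0) ?n = (1/2) *\<^sub>R (FL + FR) + blk b 0 0"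
    by (simp add: avg_def tr FL_def FR_def vec_eq_iff forall_5 bdot_def inner_add_left n1)
  hence star: "Fv_star_n D par F l p = (1/2) *\<^sub>R (FL + FR) + blk b 0 0"
    "Fv_star_n D par F (nbr D l) (nmap D l p) = - ((1/2) *\<^sub>R (FL + FR) + blk b 0 0)"
    by (simp_all add: Fv_star_n_def left_face[OF l] tr left_face_sides(5)[OF l p] bdot_minus b_def)
  have W: "W_star D par F l p = (1/2) *\<^sub>R (WL + WR)"
    "W_star D par F (nbr D l) (nmap D l p) = (1/2) *\<^sub>R (WL + WR)"
    by (simp_all add: W_star_def left_face[OF l] tr) (simp_all add: avg_def tr WL_def WR_def)
  have mu: "(WR - WL) \<bullet> blk b 0 0 = jump D (fmu F) l p * b"
    unfolding inner_5 by (simp add: WL_def WR_def Wvar_def jump_def tr)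
  have "viscous_face F l p + viscous_face F (nbr D l) (nmap D l p) = - ((WR - WL) \<bullet> blk b 0 0)"
    unfolding viscous_face_def star W left_face_sides(5)[OF l p] bdot_minus
      WL_def[symmetric] WR_def[symmetric] FL_def[symmetric] FR_def[symmetric]
    by (simp add: inner_add_left inner_add_right inner_diff_left algebra_simps add_divide_distrib)
  also have "\<dots> = - (beta D par l p * (jump D (fmu F) l p)^2)"
    unfolding mu by (simp add: b_def power2_eq_square)
  finally show ?thesis .
qed

lemma sum_viscous_face:
  "(\<Sum>e\<in>elems D. elem_bd_int D e (viscous_face F))
    = - (\<Sum>l\<in>left_faces D. face_int D l (\<lambda>p. beta D par l p * (jump D (fmu F) l p)^2))"
proof -
  have "face_int D l (viscous_face F l) = 0" if "l \<in> bfaces D" for l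
    using that by (simp add: face_int_def viscous_face_wall)
  moreover have "face_int D l (\<lambda>p. viscous_face F l p + viscous_face F (nbr D l) (nmap D l p))
      = - face_int D l (\<lambda>p. beta D par l p * (jump D (fmu F) l p)^2)"
    if l: "l \<in> left_faces D" for l
    using face_int_cmult[of D l "-1" "\<lambda>p. beta D par l p * (jump D (fmu F) l p)^2"]
      face_int_cong[of D l, OF viscous_face_interior[OF l]] by simp
  ultimately show ?thesis unfolding sum_elem_bd_int by (simp add: sum_negf)
qed

section \<open>Cahn--Hilliard terms and the work of the chemical potential\<close>

text \<open>Summing over elements, every interface contributes
  \<open>-[C\<^sub>t] G\<^sub>c\<^sup>\<star> \<cdot> n + [C\<^sub>t] {G\<^sub>c} \<cdot> n = -\<beta> [C] [C\<^sub>t]\<close>.\<close>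

lemma sum_ch_face:
  fixes F :: "'e fields" and Ct :: "'e \<Rightarrow> mindex \<Rightarrow> real"
  defines "g \<equiv> \<lambda>l p. Ct (fst l) p * Gc_star_n D par F l p
      + ((if l \<in> bfaces D then Ct (fst l) p else avg D Ct l p) - Ct (fst l) p)
        * (fGc F (fst l) p \<bullet> nvec D l p)"
  shows "pen * (\<Sum>e\<in>elems D. elem_bd_int D e g)
    = - (pen * (\<Sum>l\<in>left_faces D. face_int D l (\<lambda>p. beta D par l p * (jump D (Cat F) l p * jump D Ct l p))))
      - (\<Sum>l\<in>bfaces D. face_int D l (\<lambda>p. deriv (fw par) (Cat F (fst l) p) * Ct (fst l) p))"
proof -
  have "pen * face_int D l (g l) = - face_int D l (\<lambda>p. deriv (fw par) (Cat F (fst l) p) * Ct (fst l) p)"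
    if "l \<in> bfaces D" for l
    unfolding face_int_def sum_distrib_left sum_negf[symmetric] g_def Gc_star_n_def
    using that pos by (intro sum.cong) (simp_all add: field_simps)
  moreover have "face_int D l (\<lambda>p. g l p + g (nbr D l) (nmap D l p))
      = face_int D l (\<lambda>p. (-1) * (beta D par l p * (jump D (Cat F) l p * jump D Ct l p)))"
    if l: "l \<in> left_faces D" for l
  proof (rule face_int_cong)
    fix p assume p: "p \<in> face_nodes D l"
    note tr = left_face_traces[OF l p]
    let ?n = "nvec D l p"
    define GL where "GL = fGc F (fst l) p \<bullet> ?n"
    define GR where "GR = fGc F (fst (nbr D l)) (nmap D l p) \<bullet> ?n"
    define b where "b = beta D par l p * jump D (Cat F) l p"
    have n1: "?n \<bullet> ?n = 1" using norm_nvec[of l p] left_face[OF l] p by simp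
    have star: "Gc_star_n D par F l p = 1/2 * (GL + GR) + b"
      "Gc_star_n D par F (nbr D l) (nmap D l p) = - (1/2 * (GL + GR) + b)"
      unfolding Gc_star_n_def tr left_face_sides(5)[OF l p]
      by (simp_all add: left_face[OF l] avg_def tr GL_def GR_def b_def inner_add_left n1)
    show "g l p + g (nbr D l) (nmap D l p)
        = (-1) * (beta D par l p * (jump D (Cat F) l p * jump D Ct l p))"
      unfolding g_def star tr left_face_sides(5)[OF l p] inner_minus_right
        GL_def[symmetric] GR_def[symmetric]
      by (simp add: left_face[OF l] avg_def jump_def tr b_def field_simps)
  qed
  ultimately show ?thesis
    unfolding sum_elem_bd_int distrib_left sum_distrib_left face_int_cmult
    by (simp add: sum_negf)
qed

text \<open>As a functional of an arbitrary nodal \<open>C\<close>, the right side of the equation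
  for G_c can be evaluated at the concentration and at its time derivative alike.\<close>

definition gradc_rhs :: "'e \<Rightarrow> ('e \<Rightarrow> mindex \<Rightarrow> real) \<Rightarrow> (mindex \<Rightarrow> real^3) \<Rightarrow> real" where
  "gradc_rhs e C \<phi> =
     elem_bd_int D e (\<lambda>l p. ((if l \<in> bfaces D then C (fst l) p else avg D C l p) - C (fst l) p)
        * (\<phi> p \<bullet> nvec D l p))
     + V (contra D e \<phi>) (grad (deg D) (node D) (C e))"

lemma eq_gradc_rhs:
  "eq_gradc D F e \<phi> \<longleftrightarrow> V (\<lambda>p. jac D e p *\<^sub>R fGc F e p) \<phi> = gradc_rhs e (Cat F) \<phi>"
proof -
  have "elem_bd_int D e (\<lambda>l p. (C_star D F l p - Cat F e p) * (\<phi> p \<bullet> nvec D l p))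
      = elem_bd_int D e (\<lambda>l p. ((if l \<in> bfaces D then Cat F (fst l) p else avg D (Cat F) l p)
          - Cat F (fst l) p) * (\<phi> p \<bullet> nvec D l p))"
    by (rule elem_bd_int_cong) (simp add: C_star_def)
  thus ?thesis unfolding eq_gradc_def gradc_rhs_def by simp
qed

text \<open>The volume term pairing G_c with the gradient of C_t occurs in both equations, so it can
  be traded for the rate of the gradient energy, leaving face terms.\<close>

lemma ch_element:
  assumes mu: "eq_mu D par F e (Ct e)"
    and gc: "V (\<lambda>p. jac D e p *\<^sub>R Gct p) (fGc F e) = gradc_rhs e Ct (fGc F e)"
  shows "V (\<lambda>p. jac D e p * fmu F e p) (Ct e)
    = V (\<lambda>p. jac D e p * deriv (f0 par) (Cat F e p)) (Ct e)
    + pen * V (\<lambda>p. jac D e p *\<^sub>R Gct p) (fGc F e)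
    - pen * elem_bd_int D e (\<lambda>l p. Ct (fst l) p * Gc_star_n D par F l p
      + ((if l \<in> bfaces D then Ct (fst l) p else avg D Ct l p) - Ct (fst l) p)
        * (fGc F (fst l) p \<bullet> nvec D l p))"
proof -
  have "elem_bd_int D e (\<lambda>l p. pen * Ct e p * Gc_star_n D par F l p)
      = elem_bd_int D e (\<lambda>l p. pen * (Ct (fst l) p * Gc_star_n D par F l p))"
    by (rule elem_bd_int_cong) simp
  moreover have "elem_bd_int D e (\<lambda>l p. ((if l \<in> bfaces D then Ct (fst l) p else avg D Ct l p)
          - Ct (fst l) p) * (fGc F e p \<bullet> nvec D l p))
      = elem_bd_int D e (\<lambda>l p. ((if l \<in> bfaces D then Ct (fst l) p else avg D Ct l p)
          - Ct (fst l) p) * (fGc F (fst l) p \<bullet> nvec D l p))"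
    by (rule elem_bd_int_cong) simp
  moreover have "V (\<lambda>p. pen *\<^sub>R contra D e (fGc F e) p) (grad (deg D) (node D) (Ct e))
      = pen * V (contra D e (fGc F e)) (grad (deg D) (node D) (Ct e))"
    by (simp add: vinner_def sum_distrib_left mult_ac)
  ultimately show ?thesis
    using mu unfolding eq_mu_def gc gradc_rhs_def elem_bd_int_add elem_bd_int_cmult
    by (simp add: algebra_simps)
qed

section \<open>Element balances and their sum over the mesh\<close>

lemma mass_mult: "mass par q *v v = blk (v $ 1) (sqrt (dens par q) *\<^sub>R vrows v) (v $ 5)"
  by (simp add: vec_eq_iff forall_5 mass_def matrix_vector_mult_def sum_5)

text \<open>The root of the density in the mass matrix cancels the one dividing the momentum
  components in \<open>vel\<close>.\<close>

lemma inner_mass_W: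
  "(mass par q *v v) \<bullet> Wvar par q m
    = m * conc v + vrows q \<bullet> vrows v + pres q * pres v / K"
proof -
  have "sqrt (dens par q) \<noteq> 0" by (simp add: less_imp_neq[OF dens_pos, symmetric])
  thus ?thesis
    unfolding mass_mult inner_5
    by (simp add: Wvar_def vel_def conc_def pres_def inner_commute)
qed

lemma state_element:
  assumes e: "e \<in> elems D"
    and st: "eq_state D par flx Qt F e (Wat par F e)" and gr: "eq_grad D par F e (Fvat par F e)"
  shows "V (\<lambda>p. jac D e p * fmu F e p) (\<lambda>p. conc (Qt e p))
    + V (\<lambda>p. jac D e p * (vrows (fQ F e p) \<bullet> vrows (Qt e p) + pres (fQ F e p) * pres (Qt e p) / K)) (\<lambda>_. 1)
    = - elem_bd_int D e (inviscid_face flx F) + elem_bd_int D e (viscous_face F)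
      - V (\<lambda>p. jac D e p * (M0 par * (norm (fG F e p $ 1))^2
               + 2 * eta par (Cat F e p) * (strain (fG F e p) \<bullet> strain (fG F e p)))) (\<lambda>_. 1)"
proof -
  have "V (\<lambda>p. jac D e p *\<^sub>R (mass par (fQ F e p) *v Qt e p)) (Wat par F e)
      = V (\<lambda>p. jac D e p * fmu F e p) (\<lambda>p. conc (Qt e p))
      + V (\<lambda>p. jac D e p * (vrows (fQ F e p) \<bullet> vrows (Qt e p) + pres (fQ F e p) * pres (Qt e p) / K)) (\<lambda>_. 1)"
    unfolding vinner_def sum.distrib[symmetric]
    by (intro sum.cong) (simp_all add: inner_mass_W algebra_simps)
  moreover have "V (\<lambda>p. jac D e p *\<^sub>R fG F e p) (Fvat par F e)
      = V (\<lambda>p. jac D e p * (M0 par * (norm (fG F e p $ 1))^2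
               + 2 * eta par (Cat F e p) * (strain (fG F e p) \<bullet> strain (fG F e p)))) (\<lambda>_. 1)"
    by (simp add: vinner_def inner_Fv)
  moreover have "elem_bd_int D e (viscous_face F)
      = elem_bd_int D e (\<lambda>l p. Wat par F e p \<bullet> Fv_star_n D par F l p)
      + elem_bd_int D e (\<lambda>l p. (W_star D par F l p - Wat par F e p) \<bullet> bdot (Fvat par F e p) (nvec D l p))"
    unfolding elem_bd_int_add[symmetric]
    by (rule elem_bd_int_cong) (simp add: viscous_face_def)
  ultimately show ?thesis
    using st gr inviscid_volume[OF e, of F] inviscid_terms[OF e, of F flx]
    unfolding eq_state_def eq_grad_def by linarith
qed

text \<open>The chemical work <J mu, C_t> appears in both \<open>state_element\<close> and
  \<open>ch_element\<close>. Eliminating it couples the flow to the free energy, after which the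
  face terms are collected interface by interface.\<close>

lemma energy_balance:
  fixes F :: "'e fields" and Qt :: "'e \<Rightarrow> mindex \<Rightarrow> real^5" and Gct :: "'e \<Rightarrow> mindex \<Rightarrow> real^3"
  defines "Ct \<equiv> \<lambda>e p. conc (Qt e p)"
  assumes st: "\<And>e. e \<in> elems D \<Longrightarrow> eq_state D par flx Qt F e (Wat par F e)"
    and gr: "\<And>e. e \<in> elems D \<Longrightarrow> eq_grad D par F e (Fvat par F e)"
    and mu: "\<And>e. e \<in> elems D \<Longrightarrow> eq_mu D par F e (Ct e)"
    and gc: "\<And>e. e \<in> elems D \<Longrightarrow>
      V (\<lambda>p. jac D e p *\<^sub>R Gct e p) (fGc F e) = gradc_rhs e Ct (fGc F e)"
  shows "(\<Sum>e\<in>elems D. V (\<lambda>p. jac D e p * deriv (f0 par) (Cat F e p)) (Ct e)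
        + pen * V (\<lambda>p. jac D e p *\<^sub>R Gct e p) (fGc F e)
        + V (\<lambda>p. jac D e p * (vrows (fQ F e p) \<bullet> vrows (Qt e p)
              + pres (fQ F e p) * pres (Qt e p) / K)) (\<lambda>_. 1))
    + pen * (\<Sum>l\<in>left_faces D. face_int D l (\<lambda>p. beta D par l p * (jump D (Cat F) l p * jump D Ct l p)))
    + (\<Sum>l\<in>bfaces D. face_int D l (\<lambda>p. deriv (fw par) (Cat F (fst l) p) * Ct (fst l) p))
    = - dissipation D par F - (\<Sum>e\<in>elems D. elem_bd_int D e (inviscid_face flx F))
      - (\<Sum>l\<in>left_faces D. face_int D l (\<lambda>p. beta D par l p * (jump D (fmu F) l p)^2))"
proof -
  define B where "B = (\<lambda>e. elem_bd_int D e (\<lambda>l p. Ct (fst l) p * Gc_star_n D par F l p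
      + ((if l \<in> bfaces D then Ct (fst l) p else avg D Ct l p) - Ct (fst l) p)
        * (fGc F (fst l) p \<bullet> nvec D l p)))"
  define Ds where "Ds = (\<lambda>e. V (\<lambda>p. jac D e p * (M0 par * (norm (fG F e p $ 1))^2
               + 2 * eta par (Cat F e p) * (strain (fG F e p) \<bullet> strain (fG F e p)))) (\<lambda>_. 1))"
  define L where "L = (\<lambda>e. V (\<lambda>p. jac D e p * deriv (f0 par) (Cat F e p)) (Ct e)
        + pen * V (\<lambda>p. jac D e p *\<^sub>R Gct e p) (fGc F e)
        + V (\<lambda>p. jac D e p * (vrows (fQ F e p) \<bullet> vrows (Qt e p)
              + pres (fQ F e p) * pres (Qt e p) / K)) (\<lambda>_. 1))"
  have "L e = pen * B e
      + (- elem_bd_int D e (inviscid_face flx F) + elem_bd_int D e (viscous_face F) - Ds e)"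
    if e: "e \<in> elems D" for e
    using ch_element[OF mu[OF e] gc[OF e]] state_element[OF e st[OF e] gr[OF e]]
    unfolding B_def Ct_def Ds_def L_def by linarith
  hence "sum L (elems D) = (\<Sum>e\<in>elems D. pen * B e
      + (- elem_bd_int D e (inviscid_face flx F) + elem_bd_int D e (viscous_face F) - Ds e))"
    by (intro sum.cong refl)
  also have "\<dots> = pen * sum B (elems D) + (- (\<Sum>e\<in>elems D. elem_bd_int D e (inviscid_face flx F))
      + (\<Sum>e\<in>elems D. elem_bd_int D e (viscous_face F)) - sum Ds (elems D))"
    by (simp only: sum.distrib sum_subtractf sum_negf sum_distrib_left)
  also have "pen * sum B (elems D)
    = - (pen * (\<Sum>l\<in>left_faces D. face_int D l (\<lambda>p. beta D par l p * (jump D (Cat F) l p * jump D Ct l p))))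
      - (\<Sum>l\<in>bfaces D. face_int D l (\<lambda>p. deriv (fw par) (Cat F (fst l) p) * Ct (fst l) p))"
    unfolding B_def by (rule sum_ch_face)
  finally show ?thesis
    unfolding sum_viscous_face dissipation_def L_def Ds_def by linarith
qed

text \<open>Mesh data are constant in time and \<open>C\<close> enters linearly. The hypothesis
  ranges over all elements because the average reads the trace of a neighbour.\<close>

lemma DERIV_gradc_rhs:
  assumes e: "e \<in> elems D"
    and C: "\<And>e p. e \<in> elems D \<Longrightarrow> p \<in> nodes (deg D) \<Longrightarrow>
      ((\<lambda>s. C s e p) has_real_derivative Ct e p) (at t within S)"
  shows "((\<lambda>s. gradc_rhs e (C s) \<phi>) has_real_derivative gradc_rhs e Ct \<phi>) (at t within S)"
proof -
  have face: "((\<lambda>s. (if l \<in> bfaces D then C s (fst l) p else avg D (C s) l p) - C s (fst l) p)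
      has_real_derivative (if l \<in> bfaces D then Ct (fst l) p else avg D Ct l p) - Ct (fst l) p) (at t within S)"
    if l: "l \<in> lfaces D" and p: "p \<in> face_nodes D l" for l p
  proof -
    have own: "((\<lambda>s. C s (fst l) p) has_real_derivative Ct (fst l) p) (at t within S)"
      using l p by (intro C lface_elem face_nodes_nodes)
    moreover have "((\<lambda>s. avg D (C s) l p) has_real_derivative avg D Ct l p) (at t within S)" if b: "l \<notin> bfaces D"
    proof -
      have "((\<lambda>s. C s (fst (nbr D l)) (nmap D l p))
          has_real_derivative Ct (fst (nbr D l)) (nmap D l p)) (at t within S)"
        using interior_face(1)[of l] interior_face_node(4)[of l p] l p b
        by (intro C lface_elem) (auto intro: face_nodes_nodes)
      thus ?thesis using own b unfolding avg_def atL_def atR_def lside_def rside_def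
        by (auto intro!: DERIV_add DERIV_cdivide)
    qed
    ultimately show ?thesis by (auto intro!: DERIV_diff)
  qed
  have "((\<lambda>s. pd (deg D) (node D) d (C s e) p) has_real_derivative pd (deg D) (node D) d (Ct e) p) (at t within S)"
    if "p \<in> nodes (deg D)" for d p
    unfolding pd_def real_scaleR_def using that e
    by (intro DERIV_sum DERIV_cmult C) (auto intro: nodes_fun_upd)
  thus ?thesis
    unfolding gradc_rhs_def elem_bd_int_def face_int_def vinner_def inner_vec_def[of "_ :: real^3"]
      grad_def vec_lambda_beta inner_real_def case_prod_unfold prod.collapse
    using e
    by (intro DERIV_add DERIV_sum DERIV_cmult DERIV_cmult_right face) (auto simp: lfaces_def)
qed

section \<open>Time derivative of the discrete entropy\<close>

text \<open>In this form every term is a differentiable function of the state components and G_c,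
  with no density factor left.\<close>

lemma entropy_density_eq:
  "entropy_density par F e p = f0 par (Cat F e p) + pen / 2 * (fGc F e p \<bullet> fGc F e p)
    + 1/2 * (vrows (fQ F e p) \<bullet> vrows (fQ F e p)) + (pres (fQ F e p))^2 / (2 * K)"
proof -
  have "dens par q * (norm (vel par q))^2 = vrows q \<bullet> vrows q" for q
    using less_imp_neq[OF dens_pos, of q]
    by (simp add: vel_def power2_norm_eq_inner power_divide less_imp_le[OF dens_pos])
  thus ?thesis
    by (simp add: entropy_density_def power2_norm_eq_inner)
qed

lemma DERIV_f0: "(f0 par has_real_derivative deriv (f0 par) c) (at c)"
proof -
  have "\<exists>d. (f0 par has_real_derivative d) (at c)"
    unfolding f0_def[abs_def] by (rule exI) (rule derivative_eq_intros refl)+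
  thus ?thesis using DERIV_imp_deriv by blast
qed

lemma DERIV_fw: "(fw par has_real_derivative deriv (fw par) c) (at c)"
  using valid by (simp add: valid_params_def DERIV_deriv_iff_real_differentiable)

lemma DERIV_face_int:
  assumes "\<And>p. p \<in> face_nodes D l \<Longrightarrow> ((\<lambda>s. f s p) has_real_derivative f' p) (at t within S)"
  shows "((\<lambda>s. face_int D l (f s)) has_real_derivative face_int D l f') (at t within S)"
  unfolding face_int_def by (intro DERIV_sum DERIV_cmult assms)

lemma has_derivative_energy:
  fixes sol :: "real \<Rightarrow> 'e fields"
  assumes sol: "dg_solution D par flx I sol" and t: "t \<in> I" and lim: "at t within I \<noteq> bot"
  shows "((\<lambda>s. discrete_entropy D par (sol s) + surface_energy D par (sol s)) has_real_derivative
      (- dissipation D par (sol t) - (\<Sum>e\<in>elems D. elem_bd_int D e (inviscid_face flx (sol t)))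
       - (\<Sum>l\<in>left_faces D. face_int D l (\<lambda>p. beta D par l p * (jump D (fmu (sol t)) l p)^2))))
    (at t within I)"
proof -
  define Qt where "Qt = (\<lambda>e p. vector_derivative (\<lambda>s. fQ (sol s) e p) (at t within I))"
  define Ct where "Ct = (\<lambda>e p. conc (Qt e p))"
  have Q: "((\<lambda>s. fQ (sol s) e p $ i) has_real_derivative Qt e p $ i) (at t within I)"
    if "e \<in> elems D" "p \<in> nodes (deg D)" for e p i
  proof -
    have "(\<lambda>s. fQ (sol s) e p) differentiable (at t within I)"
      using sol t that unfolding dg_solution_def by blast
    hence "((\<lambda>s. fQ (sol s) e p) has_vector_derivative Qt e p) (at t within I)"
      unfolding Qt_def by (simp add: vector_derivative_works)
    thus ?thesis
      unfolding has_real_derivative_iff_has_vector_derivative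
      by (rule bounded_linear.has_vector_derivative[OF bounded_linear_vec_nth])
  qed
  hence C: "((\<lambda>s. Cat (sol s) e p) has_real_derivative Ct e p) (at t within I)"
    if "e \<in> elems D" "p \<in> nodes (deg D)" for e p
    using that by (simp add: conc_def Ct_def)
  have gradc: "V (\<lambda>p. jac D e p *\<^sub>R fGc (sol s) e p) \<phi> = gradc_rhs e (Cat (sol s)) \<phi>"
    if "s \<in> I" "e \<in> elems D" for s e \<phi>
    using sol that unfolding dg_solution_def eq_gradc_rhs by blast
  \<comment> \<open>Nodal test functions solve the last equation of the scheme for \<open>G\<^sub>c\<close>, linearly in \<open>C\<close>;
    this is why \<open>G\<^sub>c\<close> is differentiable in time.\<close>
  define nodal where "nodal = (\<lambda>(p :: mindex) (k :: 3) q. if q = p then axis k 1 else (0 :: real^3))"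
  have V_nodal: "V (\<lambda>p. jac D e p *\<^sub>R G p) (nodal p k) = weight (wgt D) p * jac D e p * G p $ k"
    if "p \<in> nodes (deg D)" for e G p k
    using that by (simp add: vinner_def nodal_def if_distrib inner_axis cong: if_cong)
  define Gct where "Gct = (\<lambda>e p. \<chi> k. gradc_rhs e Ct (nodal p k) / (weight (wgt D) p * jac D e p))"
  have G: "((\<lambda>s. fGc (sol s) e p $ k) has_real_derivative Gct e p $ k) (at t within I)"
    if e: "e \<in> elems D" and p: "p \<in> nodes (deg D)" for e p k
  proof -
    have "fGc (sol s) e p $ k = gradc_rhs e (Cat (sol s)) (nodal p k) / (weight (wgt D) p * jac D e p)"
      if "s \<in> I" for s
    proof -
      have "weight (wgt D) p * jac D e p \<noteq> 0"
        using mult_pos_pos[OF weight_pos[OF p] jac_pos[OF e p]] by (rule less_imp_neq[symmetric])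
      thus ?thesis
        using gradc[OF that e, of "nodal p k"] unfolding V_nodal[OF p]
        by (metis nonzero_mult_div_cancel_left)
    qed
    moreover have "((\<lambda>s. gradc_rhs e (Cat (sol s)) (nodal p k) / (weight (wgt D) p * jac D e p))
        has_real_derivative Gct e p $ k) (at t within I)"
      unfolding Gct_def vec_lambda_beta by (intro DERIV_cdivide DERIV_gradc_rhs e C)
    ultimately show ?thesis
      unfolding has_field_derivative_def using t by (rule_tac has_derivative_transform) auto
  qed
  \<comment> \<open>The equation for G_c holds at every time in \<open>I\<close>, so both sides have
    the same derivative; uniqueness of derivatives within \<open>I\<close> rests on
    \<open>lim\<close>.\<close>
  have gc: "V (\<lambda>p. jac D e p *\<^sub>R Gct e p) \<phi> = gradc_rhs e Ct \<phi>" if e: "e \<in> elems D" for e \<phi>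
  proof -
    have "((\<lambda>s. V (\<lambda>p. jac D e p *\<^sub>R fGc (sol s) e p) \<phi>) has_real_derivative
        V (\<lambda>p. jac D e p *\<^sub>R Gct e p) \<phi>) (at t within I)"
      unfolding vinner_def inner_vec_def inner_real_def vector_scaleR_component real_scaleR_def
      by (intro DERIV_sum DERIV_cmult DERIV_cmult_right G e)
    moreover have "((\<lambda>s. V (\<lambda>p. jac D e p *\<^sub>R fGc (sol s) e p) \<phi>) has_real_derivative
        gradc_rhs e Ct \<phi>) (at t within I)"
      unfolding has_field_derivative_def
      by (rule has_derivative_transform[OF t gradc[OF _ e]])
         (auto intro!: DERIV_gradc_rhs e C simp flip: has_field_derivative_def)
    ultimately show ?thesis using lim by (rule has_field_derivative_unique)
  qed
  have density: "((\<lambda>s. entropy_density par (sol s) e p) has_real_derivative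
      deriv (f0 par) (Cat (sol t) e p) * Ct e p + pen * (Gct e p \<bullet> fGc (sol t) e p)
      + (vrows (fQ (sol t) e p) \<bullet> vrows (Qt e p) + pres (fQ (sol t) e p) * pres (Qt e p) / K))
      (at t within I)"
    if e: "e \<in> elems D" and p: "p \<in> nodes (deg D)" for e p
  proof -
    have v: "((\<lambda>s. vrows (fQ (sol s) e p) $ k) has_real_derivative vrows (Qt e p) $ k) (at t within I)" for k
      using Q[OF e p] by (simp add: vrows_def)
    have P: "((\<lambda>s. pres (fQ (sol s) e p)) has_real_derivative pres (Qt e p)) (at t within I)"
      using Q[OF e p] by (simp add: pres_def)
    have "((\<lambda>s. entropy_density par (sol s) e p) has_real_derivative
      deriv (f0 par) (Cat (sol t) e p) * Ct e p + pen / 2 * (2 * (fGc (sol t) e p \<bullet> Gct e p))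
      + 1/2 * (2 * (vrows (fQ (sol t) e p) \<bullet> vrows (Qt e p)))
      + of_nat 2 * (pres (Qt e p) * pres (fQ (sol t) e p) ^ (2 - Suc 0)) / (2 * K)) (at t within I)"
      unfolding entropy_density_eq
      by (intro DERIV_add DERIV_cmult DERIV_cdivide DERIV_power DERIV_inner_self
          DERIV_chain2[OF DERIV_f0] C G v P e p)
    thus ?thesis by (simp add: inner_commute ac_simps)
  qed
  have jump: "((\<lambda>s. jump D (Cat (sol s)) l p) has_real_derivative jump D Ct l p) (at t within I)"
    if l: "l \<in> left_faces D" and p: "p \<in> face_nodes D l" for l p
    unfolding jump_def left_face_traces[OF l p]
    using left_face[OF l] left_face_sides(6)[OF l p] p
    by (intro DERIV_diff C lface_elem) (auto intro: face_nodes_nodes)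
  \<comment> \<open>\<open>of_nat 2\<close> and the exponent \<open>2 - Suc 0\<close> are the
    literal output of \<open>DERIV_power\<close>, kept so that the rules apply directly. The factor
    2 later turns the coefficient 3/4 of the penalty energy into the 3/2 of
    \<open>pen\<close>.\<close>
  define E' where "E' = (\<Sum>e\<in>elems D. V (\<lambda>p. jac D e p * (
      deriv (f0 par) (Cat (sol t) e p) * Ct e p + pen * (Gct e p \<bullet> fGc (sol t) e p)
      + (vrows (fQ (sol t) e p) \<bullet> vrows (Qt e p) + pres (fQ (sol t) e p) * pres (Qt e p) / K))) (\<lambda>_. 1))
    + 3/4 * sigma par * eps par * (\<Sum>l\<in>left_faces D. face_int D l (\<lambda>p. beta D par l p *
        (of_nat 2 * (jump D Ct l p * jump D (Cat (sol t)) l p ^ (2 - Suc 0)))))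
    + (\<Sum>l\<in>bfaces D. face_int D l (\<lambda>p. deriv (fw par) (Cat (sol t) (fst l) p) * Ct (fst l) p))"
  have wall: "l \<in> bfaces D \<Longrightarrow> p \<in> face_nodes D l \<Longrightarrow> fst l \<in> elems D \<and> p \<in> nodes (deg D)" for l p
    using bfaces_lfaces lface_elem face_nodes_nodes by blast
  have "((\<lambda>s. discrete_entropy D par (sol s) + surface_energy D par (sol s)) has_real_derivative E')
      (at t within I)"
    unfolding discrete_entropy_def surface_energy_def vinner_one E'_def
    by (intro DERIV_add DERIV_sum DERIV_cmult DERIV_face_int DERIV_power density jump
        DERIV_chain2[OF DERIV_fw] C) (auto dest: wall)
  moreover have "E' = - dissipation D par (sol t)
      - (\<Sum>e\<in>elems D. elem_bd_int D e (inviscid_face flx (sol t)))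
      - (\<Sum>l\<in>left_faces D. face_int D l (\<lambda>p. beta D par l p * (jump D (fmu (sol t)) l p)^2))"
  proof -
    have eqs: "eq_state D par flx Qt (sol t) e \<phi>" "eq_grad D par (sol t) e \<psi>" "eq_mu D par (sol t) e \<zeta>"
      if "e \<in> elems D" for e \<phi> \<psi> \<zeta>
      using sol t that unfolding dg_solution_def Qt_def by blast+
    have densities: "V (\<lambda>p. jac D e p * (
        deriv (f0 par) (Cat (sol t) e p) * Ct e p + pen * (Gct e p \<bullet> fGc (sol t) e p)
        + (vrows (fQ (sol t) e p) \<bullet> vrows (Qt e p) + pres (fQ (sol t) e p) * pres (Qt e p) / K))) (\<lambda>_. 1)
      = V (\<lambda>p. jac D e p * deriv (f0 par) (Cat (sol t) e p)) (Ct e)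
        + pen * V (\<lambda>p. jac D e p *\<^sub>R Gct e p) (fGc (sol t) e)
        + V (\<lambda>p. jac D e p * (vrows (fQ (sol t) e p) \<bullet> vrows (Qt e p)
              + pres (fQ (sol t) e p) * pres (Qt e p) / K)) (\<lambda>_. 1)" for e
      unfolding vinner_def sum_distrib_left sum.distrib[symmetric]
      by (intro sum.cong) (simp_all add: algebra_simps)
    have jumps: "3/4 * sigma par * eps par * (\<Sum>l\<in>left_faces D. face_int D l (\<lambda>p. beta D par l p *
          (of_nat 2 * (jump D Ct l p * jump D (Cat (sol t)) l p ^ (2 - Suc 0)))))
        = pen * (\<Sum>l\<in>left_faces D. face_int D l
            (\<lambda>p. beta D par l p * (jump D (Cat (sol t)) l p * jump D Ct l p)))"
      by (simp add: sum_distrib_left face_int_def mult_ac)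
    show ?thesis
      unfolding E'_def densities jumps unfolding Ct_def
      by (rule energy_balance[OF eqs(1) eqs(2) eqs(3) gc[unfolded Ct_def]])
  qed
  ultimately show ?thesis by simp
qed

section \<open>Signs of the entropy and of the dissipation\<close>

lemma entropy_density_nonneg: "0 \<le> entropy_density par F e p"
  unfolding entropy_density_def f0_def
  using pos less_imp_le[OF dens_pos] by (intro add_nonneg_nonneg mult_nonneg_nonneg divide_nonneg_nonneg) auto

lemma vinner_nonneg:
  assumes "\<And>p. p \<in> nodes (deg D) \<Longrightarrow> 0 \<le> f p"
  shows "0 \<le> V f (\<lambda>_. 1 :: real)"
  unfolding vinner_one using assms less_imp_le[OF weight_pos]
  by (intro sum_nonneg mult_nonneg_nonneg)

lemma sum_beta_nonneg:
  "0 \<le> (\<Sum>l\<in>left_faces D. face_int D l (\<lambda>p. beta D par l p * (f l p)^2))"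
  using beta_nonneg pos(7) left_face(1) by (intro sum_nonneg face_int_nonneg) auto

lemma discrete_entropy_nonneg: "0 \<le> discrete_entropy D par F"
  unfolding discrete_entropy_def using pos
  by (intro add_nonneg_nonneg mult_nonneg_nonneg sum_nonneg vinner_nonneg sum_beta_nonneg
      entropy_density_nonneg less_imp_le[OF jac_pos]) auto

lemma dissipation_nonneg:
  assumes "\<forall>e\<in>elems D. \<forall>p\<in>nodes (deg D). 0 \<le> eta par (Cat F e p)"
  shows "0 \<le> dissipation D par F"
  unfolding dissipation_def using assms pos
  by (intro sum_nonneg vinner_nonneg mult_nonneg_nonneg add_nonneg_nonneg less_imp_le[OF jac_pos]) auto

end

section \<open>From the rate inequality to the bound by the initial value\<close>

lemma nonincreasing_on_interval:
  fixes f :: "real \<Rightarrow> real"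
  assumes I: "is_interval I" and ab: "a \<in> I" "b \<in> I" "a \<le> b"
    and der: "\<And>t. t \<in> I \<Longrightarrow> \<exists>d. (f has_real_derivative d) (at t within I) \<and> d \<le> 0"
  shows "f b \<le> f a"
proof -
  have "\<forall>t\<in>I. \<exists>d. (f has_real_derivative d) (at t within I) \<and> d \<le> 0" using der by blast
  from bchoice[OF this] obtain f'
    where f': "\<forall>t\<in>I. (f has_real_derivative f' t) (at t within I) \<and> f' t \<le> 0" by blast
  have sub: "{a..b} \<subseteq> I"
    using I ab unfolding is_interval_1 by (meson atLeastAtMost_iff subsetI)
  have "(f has_real_derivative f' x) (at x within {a..b})" if "a \<le> x" "x \<le> b" for x
  proof -
    have "x \<in> I" using sub that by auto
    thus ?thesis using DERIV_subset[OF _ sub] f' by blast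
  qed
  then obtain x where "x \<in> {a..b}" "f b - f a = f' x * (b - a)"
    using mvt_very_simple[OF ab(3), of f "\<lambda>x. (*) (f' x)"] unfolding has_field_derivative_def by blast
  moreover have "f' x * (b - a) \<le> 0"
    using f' sub \<open>x \<in> {a..b}\<close> ab(3) by (intro mult_nonpos_nonneg) auto
  ultimately show ?thesis by simp
qed

text \<open>A connected set with more than one point has no isolated points.\<close>

lemma at_within_interval_nontrivial:
  fixes I :: "real set"
  assumes "is_interval I" "t \<in> I" "\<And>x. I \<noteq> {x}"
  shows "at t within I \<noteq> bot"
proof -
  have "t islimpt I"
    using assms by (intro connected_imp_perfect is_interval_connected)
  thus ?thesis by (simp add: trivial_limit_within)
qed

theorem mainTheorem3:
  fixes \<Omega> :: "(real^3) set"
    and D :: "'e dg"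
    and par :: params
    and flx :: iflux
    and I :: "real set"
    and sol :: "real \<Rightarrow> 'e fields"
  assumes "dg_mesh \<Omega> D"
    and "valid_params par"
    and "is_interval I" and "0 \<in> I" and "I \<subseteq> {0..}" and "I \<noteq> {0}"
    and "dg_solution D par flx I sol"
    and "\<forall>t\<in>I. \<forall>e\<in>elems D. \<forall>p\<in>nodes (deg D). 0 \<le> eta par (Cat (sol t) e p)"
  shows "(\<forall>F :: 'e fields. 0 \<le> discrete_entropy D par F) \<and>
    (\<forall>t\<in>I. \<exists>d.
       ((\<lambda>s. discrete_entropy D par (sol s) + surface_energy D par (sol s))
          has_real_derivative d) (at t within I) \<and>
       d \<le> - dissipation D par (sol t) \<and>
       (flx = Central \<and> (\<forall>l\<in>left_faces D. \<forall>p\<in>face_nodes D l. beta D par l p = 0)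
          \<longrightarrow> d = - dissipation D par (sol t))) \<and>
    (\<forall>t\<in>I. discrete_entropy D par (sol t) + surface_energy D par (sol t)
            \<le> discrete_entropy D par (sol 0) + surface_energy D par (sol 0))"
proof -
  interpret scheme \<Omega> D par
    using assms(1,2) by unfold_locales
  let ?E = "\<lambda>s. discrete_entropy D par (sol s) + surface_energy D par (sol s)"
  let ?d = "\<lambda>t. - dissipation D par (sol t) - (\<Sum>e\<in>elems D. elem_bd_int D e (inviscid_face flx (sol t)))
       - (\<Sum>l\<in>left_faces D. face_int D l (\<lambda>p. beta D par l p * (jump D (fmu (sol t)) l p)^2))"
  have "I \<noteq> {x}" for x using assms(4,6) by blast
  hence der: "(?E has_real_derivative ?d t) (at t within I)" if "t \<in> I" for t
    using assms(3,7) that by (intro has_derivative_energy at_within_interval_nontrivial)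
  have le: "?d t \<le> - dissipation D par (sol t)" for t
    using sum_inviscid_face(1)[of flx "sol t"] sum_beta_nonneg[of "jump D (fmu (sol t))"] by linarith
  have eq: "?d t = - dissipation D par (sol t)"
    if "flx = Central" "\<forall>l\<in>left_faces D. \<forall>p\<in>face_nodes D l. beta D par l p = 0" for t
    using that sum_inviscid_face(2)[of "sol t"] by (simp add: face_int_def)
  have "?E t \<le> ?E 0" if t: "t \<in> I" for t
  proof (rule nonincreasing_on_interval[OF assms(3,4) t])
    show "0 \<le> t" using assms(5) t by auto
    fix s assume s: "s \<in> I"
    \<comment> \<open>Here the sign of \<open>eta\<close> at the nodes makes the dissipation
      non-negative, so the rate bound becomes monotonicity.\<close>
    have "?d s \<le> 0" using le[of s] dissipation_nonneg[of "sol s"] assms(8) s by fastforce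
    thus "\<exists>d. (?E has_real_derivative d) (at s within I) \<and> d \<le> 0" using der[OF s] by blast
  qed
  thus ?thesis using discrete_entropy_nonneg der le eq by blast
qed

end
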